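(* Let $\mu$ be a compactly supported Borel measure on $\mathbb{R}^d$, and let $f\in L^1\cap L^2(\mu)$. Let $E_f$ denote the support of $f$. Then $$\sqrt{\frac{1}{R^d\,|E_f^{\frac1R}|}}\ \le\ \frac{X_{1,\mu,R}(f)}{X_{2,\mu,R}(f)},$$ where $E_f^{\frac1R}$ denotes the $\frac1R$-neighborhood of the support of $f$.
   Context: $|\cdot|$ is Lebesgue measure on $\mathbb{R}^d$, $d\ge1$, and $R\ge1$ is the frequency parameter. The Fourier transform of a finite measure $\nu$ on $\mathbb{R}^d$ is $\widehat{\nu}(\xi)=\int e^{-2\pi i x\cdot\xi}\,d\nu(x)$. Fix a nonnegative $\psi\in C_c^\infty(\mathbb{R}^d)$ with $\int\psi=1$, and let $\psi_\delta(x)=\delta^{-d}\psi(x/\delta)$. For $p\in[1,\infty)$ define $$X_{p,\mu,R}(f)=\Big(R^{-d}\int_{\mathbb{R}^d}|\widehat{(f\mu)*\psi_{R^{-1}}}(\xi)|^p\,d\xi\Big)^{1/p},$$ where $f\mu$ is the measure $f\,d\mu$.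
   Formalization: The formal statement additionally assumes that the support of ψ lies in the closed unit ball; without it the inequality fails (μ = δ₀, f = 1, ψ replaced by a wide dilate λ^{-d}ψ(·/λ)). *)

theory Defs
  imports "HOL-Analysis.Analysis"
begin

primrec C_k :: "nat \<Rightarrow> ('a::euclidean_space \<Rightarrow> real) \<Rightarrow> bool" where
  "C_k 0 g \<longleftrightarrow> continuous_on UNIV g"
| "C_k (Suc k) g \<longleftrightarrow> (\<forall>x. g differentiable (at x)) \<and>
     (\<forall>v. C_k k (\<lambda>x. frechet_derivative g (at x) v))"

definition smooth :: "('a::euclidean_space \<Rightarrow> real) \<Rightarrow> bool" where
  "smooth g \<longleftrightarrow> (\<forall>k. C_k k g)"

definition measure_support :: "'a::topological_space measure \<Rightarrow> 'a set" where
  "measure_support M = {x. \<forall>U. open U \<and> x \<in> U \<longrightarrow> emeasure M U \<noteq> 0}"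

text \<open>
  The support of an element of \<open>L\<^sup>1(M)\<close>, which is only defined up to \<open>M\<close>-null sets: the complement
  of the largest open set on which \<open>f\<close> vanishes \<open>M\<close>-almost everywhere. Equivalently, the support
  of the measure \<open>f dM\<close>. It is contained in the closure of \<open>{x. f x \<noteq> 0}\<close>.
\<close>
definition function_support ::
    "'a::topological_space measure \<Rightarrow> ('a \<Rightarrow> complex) \<Rightarrow> 'a set" where
  "function_support M f = - \<Union>{U. open U \<and> (AE x in M. x \<in> U \<longrightarrow> f x = 0)}"

definition neighborhood :: "real \<Rightarrow> 'a::metric_space set \<Rightarrow> 'a set" where
  "neighborhood r E = (\<Union>x\<in>E. ball x r)"

text \<open>The Fourier transform of the measure \<open>h dM\<close>.\<close>
definition fourier ::
    "'a::euclidean_space measure \<Rightarrow> ('a \<Rightarrow> complex) \<Rightarrow> 'a \<Rightarrow> complex" where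
  "fourier M h \<xi> = (LINT x|M. exp (- (2 * pi * (x \<bullet> \<xi>)) * \<i>) * h x)"

definition rescale :: "real \<Rightarrow> ('a::euclidean_space \<Rightarrow> real) \<Rightarrow> 'a \<Rightarrow> real" where
  "rescale \<delta> \<psi> x = \<psi> (x /\<^sub>R \<delta>) / \<delta> ^ DIM('a)"

text \<open>The convolution of the measure \<open>f dM\<close> with the function \<open>\<phi>\<close>, as a density with respect to
  Lebesgue measure.\<close>
definition conv ::
    "'a::euclidean_space measure \<Rightarrow> ('a \<Rightarrow> complex) \<Rightarrow> ('a \<Rightarrow> real) \<Rightarrow> 'a \<Rightarrow> complex" where
  "conv M f \<phi> x = (LINT y|M. f y * complex_of_real (\<phi> (x - y)))"

definition X_norm ::
    "('a::euclidean_space \<Rightarrow> real) \<Rightarrow> real \<Rightarrow> 'a measure \<Rightarrow> real \<Rightarrow> ('a \<Rightarrow> complex) \<Rightarrow> real" where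
  "X_norm \<psi> p \<mu> R f =
     ((LINT \<xi>|lborel. norm (fourier lborel (conv \<mu> f (rescale (1 / R) \<psi>)) \<xi>) powr p)
        / R ^ DIM('a)) powr (1 / p)"

end

theory Submission
  imports Defs "HOL-Probability.Probability" "HOL-Complex_Analysis.Complex_Analysis"
begin

text \<open>
  Let \<open>g = (f\<mu>) * \<psi>\<^bsub>1/R\<^esub>\<close>, a continuous function vanishing outside \<open>E = E\<^sub>f\<^bsup>1/R\<^esup>\<close>, and let \<open>G\<close> be its
  Fourier transform. Then \<open>\<parallel>G\<parallel>\<^sub>2\<^sup>2 \<le> \<parallel>G\<parallel>\<^sub>\<infinity> \<parallel>G\<parallel>\<^sub>1 \<le> \<parallel>g\<parallel>\<^sub>1 \<parallel>G\<parallel>\<^sub>1 \<le> \<bar>E\<bar>\<^bsup>1/2\<^esup> \<parallel>g\<parallel>\<^sub>2 \<parallel>G\<parallel>\<^sub>1\<close>, and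
  Plancherel's identity \<open>\<parallel>g\<parallel>\<^sub>2 = \<parallel>G\<parallel>\<^sub>2\<close> gives \<open>\<parallel>G\<parallel>\<^sub>2 \<le> \<bar>E\<bar>\<^bsup>1/2\<^esup> \<parallel>G\<parallel>\<^sub>1\<close>, which is the claim.

  The division needs \<open>0 < \<parallel>G\<parallel>\<^sub>2\<close> unless \<open>f = 0\<close>. Here \<open>G\<close> is the product of the transforms of \<open>f\<mu>\<close> and of
  \<open>\<psi>\<^bsub>1/R\<^esub>\<close>; the latter is entire along each line through the origin and equals \<open>1\<close> at the origin, so its
  zeros on the line are isolated. If \<open>G = 0\<close>, the transform of \<open>f\<mu>\<close> vanishes by continuity, and
  \<open>f\<mu> = 0\<close> by uniqueness. Smoothness of \<open>\<psi>\<close> makes \<open>\<parallel>G\<parallel>\<^sub>1\<close> finite.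
\<close>

section \<open>Integration over Euclidean space\<close>

lemma fourier_eq_cis: "fourier M h \<xi> = (LINT x|M. cis (- (2 * pi * (x \<bullet> \<xi>))) * h x)"
  by (simp add: fourier_def cis_conv_exp mult.commute)

lemma continuous_on_cis' [continuous_intros]:
  "continuous_on S f \<Longrightarrow> continuous_on S (\<lambda>x. cis (f x))"
  unfolding cis_conv_exp by (intro continuous_intros)

lemma borel_measurable_cis [measurable]: "cis \<in> borel_measurable borel"
  by (intro borel_measurable_continuous_onI continuous_intros)

text \<open>\<open>lborel\<close> on the Euclidean space is the image of the product of
  one-dimensional \<open>lborel\<close>s under \<open>z -> \<Sum>b. z b *\<^sub>R b\<close>, so
  Fubini on the product applies. This reduces Gaussian and decay integrals to one variable.\<close>

lemma
  fixes f :: "'a::euclidean_space \<Rightarrow> real \<Rightarrow> 'b::{real_normed_field,banach,second_countable_topology}"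
  assumes f: "\<And>b. b \<in> Basis \<Longrightarrow> integrable lborel (f b)"
  shows integrable_lborel_prod: "integrable lborel (\<lambda>x. \<Prod>b\<in>Basis. f b (x \<bullet> b))"
    and integral_lborel_prod:
      "(LINT x|lborel. (\<Prod>b\<in>Basis. f b (x \<bullet> b))) = (\<Prod>b\<in>Basis. integral\<^sup>L lborel (f b))"
proof -
  interpret product_sigma_finite "\<lambda>_::'a. lborel::real measure" ..
  have [measurable]: "f b \<in> borel_measurable borel" if "b \<in> Basis" for b
    using borel_measurable_integrable[OF f[OF that]] by simp
  have sum: "(\<Sum>b\<in>Basis. z b *\<^sub>R b) \<bullet> b = z b" if "b \<in> Basis" for z and b :: 'a
    using that by simp
  have prod: "(\<Prod>b\<in>Basis. f b ((\<Sum>b\<in>Basis. z b *\<^sub>R b) \<bullet> b)) = (\<Prod>b\<in>Basis. f b (z b))"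
    for z :: "'a \<Rightarrow> real"
    by (intro prod.cong refl) (simp only: sum)
  have [measurable]: "(\<lambda>x. \<Prod>b\<in>Basis. f b (x \<bullet> b)) \<in> borel_measurable borel"
    by measurable
  have meas: "(\<lambda>z. \<Sum>b\<in>Basis. z b *\<^sub>R b) \<in> (\<Pi>\<^sub>M b\<in>Basis. lborel) \<rightarrow>\<^sub>M (borel :: 'a measure)"
    by measurable
  show "integrable lborel (\<lambda>x. \<Prod>b\<in>Basis. f b (x \<bullet> b))"
    by (subst lborel_eq, subst integrable_distr_eq[OF meas])
       (simp_all only: prod, auto intro!: product_integrable_prod f)
  show "(LINT x|lborel. (\<Prod>b\<in>Basis. f b (x \<bullet> b))) = (\<Prod>b\<in>Basis. integral\<^sup>L lborel (f b))"
    by (subst lborel_eq, subst integral_distr[OF meas])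
       (simp_all only: prod, auto intro!: product_integral_prod f)
qed

text \<open>Pushing \<open>lborel\<close> forward along the affine map rescales it by a constant
  density. A negative \<open>c\<close> is allowed because convolutions are rewritten with the
  substitution \<open>y = x - \<delta> z\<close>.\<close>

lemma
  fixes f :: "'a::euclidean_space \<Rightarrow> 'b::{banach,second_countable_topology}"
  assumes c: "c \<noteq> 0" and [measurable]: "f \<in> borel_measurable borel"
  shows integrable_lborel_affine:
      "integrable lborel (\<lambda>x. f (t + c *\<^sub>R x)) \<longleftrightarrow> integrable lborel f"
    and integral_lborel_affine:
      "(LINT x|lborel. f (t + c *\<^sub>R x)) = (LINT x|lborel. f x) /\<^sub>R \<bar>c\<bar> ^ DIM('a)"
proof -
  have d: "lborel = density (distr lborel borel (\<lambda>x::'a. t + c *\<^sub>R x)) (\<lambda>_. ennreal (\<bar>c\<bar> ^ DIM('a)))"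
    using lborel_affine[OF c, of t] c by (simp flip: ennreal_power)
  show "integrable lborel (\<lambda>x. f (t + c *\<^sub>R x)) \<longleftrightarrow> integrable lborel f"
  proof
    assume "integrable lborel (\<lambda>x. f (t + c *\<^sub>R x))"
    then show "integrable lborel f"
      by (subst d, subst integrable_density) (auto simp: integrable_distr_eq)
  next
    assume "integrable lborel f"
    then have "integrable lborel (\<lambda>x. \<bar>c\<bar> ^ DIM('a) *\<^sub>R f (t + c *\<^sub>R x))"
      by (subst (asm) d, subst (asm) integrable_density) (auto simp: integrable_distr_eq)
    then have "integrable lborel (\<lambda>x. inverse (\<bar>c\<bar> ^ DIM('a)) *\<^sub>R \<bar>c\<bar> ^ DIM('a) *\<^sub>R f (t + c *\<^sub>R x))"
      by (rule integrable_scaleR_right)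
    then show "integrable lborel (\<lambda>x. f (t + c *\<^sub>R x))"
      using c by simp
  qed
  have "(LINT x|lborel. f x) = \<bar>c\<bar> ^ DIM('a) *\<^sub>R (LINT x|lborel. f (t + c *\<^sub>R x))"
    by (subst d, subst integral_density) (auto simp: integral_distr)
  then show "(LINT x|lborel. f (t + c *\<^sub>R x)) = (LINT x|lborel. f x) /\<^sub>R \<bar>c\<bar> ^ DIM('a)"
    using c by simp
qed

section \<open>Rescaled kernels and approximate identities\<close>

lemma rescale_measurable [measurable]:
  assumes [measurable]: "\<phi> \<in> borel_measurable borel"
  shows "rescale \<delta> \<phi> \<in> borel_measurable borel"
  unfolding rescale_def[abs_def] by measurable

lemma integrable_rescale:
  fixes \<phi> :: "'a::euclidean_space \<Rightarrow> real"
  assumes "0 < \<delta>" and "integrable lborel \<phi>"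
  shows "integrable lborel (rescale \<delta> \<phi>)"
proof -
  have "integrable lborel (\<lambda>x. \<phi> (x /\<^sub>R \<delta>))"
    using integrable_lborel_affine[of "inverse \<delta>" \<phi> 0] assms by auto
  then show ?thesis
    unfolding rescale_def by simp
qed

text \<open>The substitution \<open>y = x - \<delta> z\<close> moves the dependence on
  \<open>\<delta>\<close> from the kernel to \<open>u\<close>, so that one majorant serves all
  \<open>\<delta>\<close> when \<open>u\<close> is bounded.\<close>

lemma conv_lborel_rescale:
  fixes \<phi> :: "'a::euclidean_space \<Rightarrow> real"
  assumes \<delta>: "0 < \<delta>" and [measurable]: "u \<in> borel_measurable borel" "\<phi> \<in> borel_measurable borel"
  shows "conv lborel u (rescale \<delta> \<phi>) x = (LINT z|lborel. u (x - \<delta> *\<^sub>R z) * complex_of_real (\<phi> z))"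
proof -
  have "(LINT z|lborel. u (x - \<delta> *\<^sub>R z) * complex_of_real (rescale \<delta> \<phi> (x - (x - \<delta> *\<^sub>R z))))
      = conv lborel u (rescale \<delta> \<phi>) x /\<^sub>R \<delta> ^ DIM('a)"
    using integral_lborel_affine[of "-\<delta>" "\<lambda>y. u y * complex_of_real (rescale \<delta> \<phi> (x - y))" x] \<delta>
    by (simp add: conv_def)
  moreover have "(LINT z|lborel. u (x - \<delta> *\<^sub>R z) * complex_of_real (rescale \<delta> \<phi> (x - (x - \<delta> *\<^sub>R z))))
      = (LINT z|lborel. u (x - \<delta> *\<^sub>R z) * complex_of_real (\<phi> z)) /\<^sub>R \<delta> ^ DIM('a)"
  proof -
    have "u (x - \<delta> *\<^sub>R z) * complex_of_real (rescale \<delta> \<phi> (x - (x - \<delta> *\<^sub>R z)))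
        = inverse (\<delta> ^ DIM('a)) *\<^sub>R (u (x - \<delta> *\<^sub>R z) * complex_of_real (\<phi> z))" for z
      using \<delta> by (simp add: rescale_def scaleR_conv_of_real divide_inverse)
    then show ?thesis
      by (simp only: integral_scaleR_right)
  qed
  ultimately show ?thesis
    using \<delta> by simp
qed

text \<open>Approximate identity: in the substituted integral the integrand converges pointwise by
  continuity of \<open>u\<close> and is dominated by \<open>B * norm (\<phi> z)\<close>; the limit
  is \<open>u x\<close> because \<open>\<phi>\<close> has mass 1.\<close>

lemma conv_rescale_tendsto:
  fixes \<phi> :: "'a::euclidean_space \<Rightarrow> real"
  assumes u: "continuous_on UNIV u" and B: "\<And>x. norm (u x) \<le> B"
    and \<phi>: "integrable lborel \<phi>" "(LINT x|lborel. \<phi> x) = 1"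
  shows "(\<lambda>n. conv lborel u (rescale (1 / Suc n) \<phi>) x) \<longlonglongrightarrow> u x"
proof -
  have [measurable]: "u \<in> borel_measurable borel" "\<phi> \<in> borel_measurable borel"
    using \<phi> borel_measurable_continuous_onI[OF u] by auto
  have "(\<lambda>n. LINT z|lborel. u (x - (1 / Suc n) *\<^sub>R z) * complex_of_real (\<phi> z))
      \<longlonglongrightarrow> (LINT z|lborel. u x * complex_of_real (\<phi> z))"
  proof (rule integral_dominated_convergence[where w = "\<lambda>z. B * norm (\<phi> z)"])
    show "integrable lborel (\<lambda>z. B * norm (\<phi> z))"
      using \<phi> by (intro integrable_mult_right integrable_norm)
    show "AE z in lborel. (\<lambda>n. u (x - (1 / Suc n) *\<^sub>R z) * complex_of_real (\<phi> z))
        \<longlonglongrightarrow> u x * complex_of_real (\<phi> z)"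
    proof (intro AE_I2 tendsto_mult tendsto_const)
      fix z :: 'a
      have "(\<lambda>n. x - (1 / Suc n) *\<^sub>R z) \<longlonglongrightarrow> x - 0 *\<^sub>R z"
        by (intro tendsto_intros LIMSEQ_Suc lim_1_over_n)
      then have "(\<lambda>n. x - (1 / Suc n) *\<^sub>R z) \<longlonglongrightarrow> x"
        by simp
      moreover have "isCont u x"
        using u by (simp add: continuous_on_eq_continuous_at)
      ultimately show "(\<lambda>n. u (x - (1 / Suc n) *\<^sub>R z)) \<longlonglongrightarrow> u x"
        by (rule isCont_tendsto_compose[rotated])
    qed
    show "AE z in lborel. norm (u (x - (1 / Suc n) *\<^sub>R z) * complex_of_real (\<phi> z)) \<le> B * norm (\<phi> z)"
      for n
      by (intro AE_I2) (auto simp: norm_mult intro!: mult_right_mono B)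
  qed measurable
  then show ?thesis
    using \<phi> by (simp add: conv_lborel_rescale)
qed

text \<open>Tonelli for a product of functions of separate variables. It supplies the majorants that
  justify the exchanges of integrals in \<open>conv_gaussian_eq_fourier\<close> and
  \<open>plancherel\<close>.\<close>

lemma integrable_pair_mult:
  fixes a :: "'a \<Rightarrow> 'c::{real_normed_field,banach,second_countable_topology}"
  assumes "sigma_finite_measure M" "sigma_finite_measure N" "integrable M a" "integrable N b"
  shows "integrable (M \<Otimes>\<^sub>M N) (\<lambda>(x, y). a x * b y)"
proof -
  interpret pair_sigma_finite M N
    using assms by (simp add: pair_sigma_finite_def)
  have [measurable]: "a \<in> borel_measurable M" "b \<in> borel_measurable N"
    using assms by auto
  show ?thesis
    using assms by (intro Fubini_integrable) (auto simp: norm_mult)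
qed

section \<open>Gaussian kernels, Fourier inversion and Plancherel\<close>

text \<open>The standard normal density, written as a product over coordinates so that
  one-dimensional facts transfer factor by factor; \<open>gaussian_eq\<close> gives the radial
  form.\<close>

definition gaussian :: "'a::euclidean_space \<Rightarrow> real" where
  "gaussian x = (\<Prod>b\<in>Basis. std_normal_density (x \<bullet> b))"

lemma prod_exp_norm_squared:
  fixes x :: "'a::euclidean_space"
  shows "(\<Prod>b\<in>Basis. exp (- (x \<bullet> b)\<^sup>2 / 2)) = exp (- (norm x)\<^sup>2 / 2)"
  unfolding power2_norm_eq_inner euclidean_inner[of x x]
  by (simp add: exp_sum[symmetric] sum_negf sum_divide_distrib power2_eq_square)

lemma gaussian_eq:
  fixes x :: "'a::euclidean_space"
  shows "gaussian x = exp (- (norm x)\<^sup>2 / 2) / sqrt (2 * pi) ^ DIM('a)"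
proof -
  have "gaussian x = (\<Prod>b\<in>Basis. exp (- (x \<bullet> b)\<^sup>2 / 2) * (1 / sqrt (2 * pi)))"
    unfolding gaussian_def std_normal_density_def by (simp add: mult.commute)
  also have "\<dots> = exp (- (norm x)\<^sup>2 / 2) * (1 / sqrt (2 * pi)) ^ DIM('a)"
    unfolding prod.distrib prod_exp_norm_squared by simp
  finally show ?thesis
    by (simp add: power_divide)
qed

lemma gaussian_measurable [measurable]: "gaussian \<in> borel_measurable borel"
  unfolding gaussian_eq[abs_def] by measurable

lemma integrable_gaussian: "integrable lborel gaussian"
  unfolding gaussian_def[abs_def] by (intro integrable_lborel_prod) auto

lemma integral_gaussian: "(LINT x|lborel. gaussian x) = 1"
  unfolding gaussian_def by (subst integral_lborel_prod) auto

lemma gaussian_minus: "gaussian (- x) = gaussian x"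
  by (simp add: gaussian_eq)

text \<open>Both the character and the Gaussian factor over coordinates, and each factor is the
  characteristic function of the standard normal distribution.\<close>

lemma integral_cis_gaussian:
  fixes \<xi> :: "'a::euclidean_space"
  shows "(LINT x|lborel. cis (x \<bullet> \<xi>) * complex_of_real (gaussian x))
    = complex_of_real (exp (- (norm \<xi>)\<^sup>2 / 2))"
proof -
  have 1: "(LINT t|lborel. cis (t * s) * complex_of_real (std_normal_density t))
      = complex_of_real (exp (- s\<^sup>2 / 2))" for s
  proof -
    have "char std_normal_distribution s
        = (LINT t|lborel. std_normal_density t *\<^sub>R cis (t * s))"
      unfolding char_def
      by (subst integral_density) (auto simp: cis_conv_exp mult.commute)
    then show ?thesis
      by (simp add: char_std_normal_distribution scaleR_conv_of_real mult.commute)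
  qed
  have int: "integrable lborel (\<lambda>t. cis (t * s) * complex_of_real (std_normal_density t))" for s
    by (rule Bochner_Integration.integrable_bound[where f = "std_normal_density"])
       (auto simp: norm_mult)
  have "cis (x \<bullet> \<xi>) = (\<Prod>b\<in>Basis. cis ((x \<bullet> b) * (\<xi> \<bullet> b)))" for x
    unfolding euclidean_inner[of x \<xi>] cis_conv_exp by (simp add: exp_sum sum_distrib_left)
  then have "(LINT x|lborel. cis (x \<bullet> \<xi>) * complex_of_real (gaussian x))
      = (LINT x|lborel. (\<Prod>b\<in>Basis. cis ((x \<bullet> b) * (\<xi> \<bullet> b)) * complex_of_real (std_normal_density (x \<bullet> b))))"
    by (simp add: gaussian_def prod.distrib)
  also have "\<dots> = (\<Prod>b\<in>Basis. complex_of_real (exp (- (\<xi> \<bullet> b)\<^sup>2 / 2)))"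
    by (subst integral_lborel_prod) (simp_all only: int 1)
  also have "\<dots> = complex_of_real (exp (- (norm \<xi>)\<^sup>2 / 2))"
    by (simp only: of_real_prod[symmetric] prod_exp_norm_squared)
  finally show ?thesis .
qed

lemma integrable_exp_norm_squared:
  assumes c: "c \<noteq> 0"
  shows "integrable lborel (\<lambda>\<xi>::'a::euclidean_space. exp (- (norm (c *\<^sub>R \<xi>))\<^sup>2 / 2))"
proof -
  have "(\<lambda>\<xi>::'a. exp (- (norm (c *\<^sub>R \<xi>))\<^sup>2 / 2)) = (\<lambda>\<xi>. sqrt (2 * pi) ^ DIM('a) * gaussian (0 + c *\<^sub>R \<xi>))"
    by (auto simp: gaussian_eq)
  moreover have "integrable lborel (\<lambda>\<xi>::'a. sqrt (2 * pi) ^ DIM('a) * gaussian (0 + c *\<^sub>R \<xi>))"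
    using c by (intro integrable_mult_right integrable_lborel_affine[THEN iffD2] integrable_gaussian) auto
  ultimately show ?thesis by simp
qed

text \<open>The substitution \<open>\<eta> = 2 * pi * \<delta> * \<xi>\<close> in
  \<open>integral_cis_gaussian\<close>: it exhibits the mollifying kernel as a superposition of
  characters with an integrable Gaussian weight.\<close>

lemma rescale_gaussian_eq_integral:
  fixes w :: "'a::euclidean_space"
  assumes \<delta>: "0 < \<delta>"
  shows "(LINT \<xi>|lborel. cis (2 * pi * (w \<bullet> \<xi>)) * complex_of_real (exp (- (norm ((2 * pi * \<delta>) *\<^sub>R \<xi>))\<^sup>2 / 2)))
    = complex_of_real (rescale \<delta> gaussian w)"
proof -
  let ?c = "2 * pi * \<delta>" and ?s = "sqrt (2 * pi) ^ DIM('a)"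
  have c: "?c > 0" using \<delta> by simp
  have "(LINT \<xi>|lborel. cis (2 * pi * (w \<bullet> \<xi>)) * complex_of_real (exp (- (norm (?c *\<^sub>R \<xi>))\<^sup>2 / 2)))
     = (LINT \<xi>|lborel. complex_of_real ?s * (cis ((0 + ?c *\<^sub>R \<xi>) \<bullet> (w /\<^sub>R \<delta>)) * complex_of_real (gaussian (0 + ?c *\<^sub>R \<xi>))))"
    using \<delta> by (intro Bochner_Integration.integral_cong refl)
      (simp add: gaussian_eq inner_commute field_simps)
  also have "\<dots> = complex_of_real ?s *
     (LINT \<xi>|lborel. cis ((0 + ?c *\<^sub>R \<xi>) \<bullet> (w /\<^sub>R \<delta>)) * complex_of_real (gaussian (0 + ?c *\<^sub>R \<xi>)))"
    by (rule integral_mult_right_zero)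
  also have "\<dots> = complex_of_real ?s *
      ((LINT \<eta>|lborel. cis (\<eta> \<bullet> (w /\<^sub>R \<delta>)) * complex_of_real (gaussian \<eta>)) /\<^sub>R \<bar>?c\<bar> ^ DIM('a))"
    using c by (subst integral_lborel_affine[where f="\<lambda>\<eta>. cis (\<eta> \<bullet> (w /\<^sub>R \<delta>)) * complex_of_real (gaussian \<eta>)"]) auto
  also have "\<dots> = complex_of_real (?s * exp (- (norm (w /\<^sub>R \<delta>))\<^sup>2 / 2) / ?c ^ DIM('a))"
  proof -
    have "complex_of_real a * (complex_of_real e /\<^sub>R b) = complex_of_real (a * e / b)" for a b e
      by (simp add: scaleR_conv_of_real divide_inverse)
    then show ?thesis
      unfolding integral_cis_gaussian abs_of_pos[OF c] .
  qed
  also have "?s * exp (- (norm (w /\<^sub>R \<delta>))\<^sup>2 / 2) / ?c ^ DIM('a) = rescale \<delta> gaussian w"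
  proof -
    \<comment> \<open>The Jacobian \<open>?c ^ DIM('a)\<close> contains \<open>?s\<close> twice: one
      copy cancels the factor \<open>?s\<close> in front, the other is the normalising constant of
      \<open>gaussian\<close>.\<close>
    have "?c ^ DIM('a) = ?s * ?s * \<delta> ^ DIM('a)"
      unfolding power_mult_distrib[symmetric] by simp
    then show ?thesis
      using \<delta> by (simp add: rescale_def gaussian_eq)
  qed
  finally show ?thesis .
qed

text \<open>Fubini after inserting the character representation of the kernel. The mollified measure
  thus depends only on the transform of \<open>h dM\<close>; inversion uses this with Lebesgue
  measure, uniqueness with a general \<open>M\<close>.\<close>

lemma conv_gaussian_eq_fourier:
  fixes h :: "'a::euclidean_space \<Rightarrow> complex"
  assumes M: "sigma_finite_measure M" "sets M = sets borel" and h: "integrable M h" and \<delta>: "0 < \<delta>"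
  shows "conv M h (rescale \<delta> gaussian) x =
    (LINT \<xi>|lborel. fourier M h \<xi> * cis (2 * pi * (x \<bullet> \<xi>))
        * complex_of_real (exp (- (norm ((2 * pi * \<delta>) *\<^sub>R \<xi>))\<^sup>2 / 2)))"
proof -
  interpret pair_sigma_finite M lborel
    using M sigma_finite_lborel by (simp add: pair_sigma_finite_def)
  let ?K = "\<lambda>\<xi>::'a. exp (- (norm ((2 * pi * \<delta>) *\<^sub>R \<xi>))\<^sup>2 / 2)"
  let ?F = "\<lambda>y \<xi>. h y * (cis (2 * pi * ((x - y) \<bullet> \<xi>)) * complex_of_real (?K \<xi>))"
  note [measurable_cong] = M(2)
  have [measurable]: "h \<in> borel_measurable M"
    using h by auto
  have "integrable (M \<Otimes>\<^sub>M lborel) (\<lambda>(y, \<xi>). norm (h y) * ?K \<xi>)"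
    using M \<delta> h by (intro integrable_pair_mult integrable_exp_norm_squared sigma_finite_lborel) auto
  then have "integrable (M \<Otimes>\<^sub>M lborel) (\<lambda>(y, \<xi>). ?F y \<xi>)"
    by (rule Bochner_Integration.integrable_bound) (auto simp: norm_mult)
  then have "(LINT \<xi>|lborel. LINT y|M. ?F y \<xi>) = (LINT y|M. LINT \<xi>|lborel. ?F y \<xi>)"
    by (rule Fubini_integral)
  moreover have "(LINT y|M. ?F y \<xi>)
      = fourier M h \<xi> * cis (2 * pi * (x \<bullet> \<xi>)) * complex_of_real (?K \<xi>)" for \<xi>
  proof -
    have cis: "cis (2 * pi * ((x - y) \<bullet> \<xi>)) = cis (- (2 * pi * (y \<bullet> \<xi>))) * cis (2 * pi * (x \<bullet> \<xi>))" for y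
      by (simp add: cis_mult inner_diff_left algebra_simps)
    have "(LINT y|M. ?F y \<xi>) = (LINT y|M. (cis (- (2 * pi * (y \<bullet> \<xi>))) * h y) * (cis (2 * pi * (x \<bullet> \<xi>)) * complex_of_real (?K \<xi>)))"
      unfolding cis by (intro Bochner_Integration.integral_cong refl) (simp only: mult_ac)
    also have "\<dots> = fourier M h \<xi> * (cis (2 * pi * (x \<bullet> \<xi>)) * complex_of_real (?K \<xi>))"
      unfolding fourier_eq_cis by (rule integral_mult_left_zero)
    finally show ?thesis
      by (simp only: mult.assoc)
  qed
  moreover have "(LINT \<xi>|lborel. ?F y \<xi>) = h y * complex_of_real (rescale \<delta> gaussian (x - y))" for y
    unfolding rescale_gaussian_eq_integral[OF \<delta>, symmetric] by (rule integral_mult_right_zero)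
  ultimately show ?thesis
    by (simp only: conv_def)
qed

section \<open>Bounds and continuity of the transform, inversion and Plancherel\<close>

lemma norm_fourier_le: "integrable M h \<Longrightarrow> norm (fourier M h \<xi>) \<le> (LINT x|M. norm (h x))"
  unfolding fourier_eq_cis by (rule order_trans[OF integral_norm_bound]) (simp add: norm_mult)

lemma continuous_on_fourier:
  assumes M: "sets M = sets borel" and h: "integrable M h"
  shows "continuous_on UNIV (fourier M h)"
  unfolding continuous_on_sequentially
proof (intro allI ballI impI)
  fix X :: "nat \<Rightarrow> 'a" and \<xi> :: 'a assume "(\<forall>n. X n \<in> UNIV) \<and> X \<longlonglongrightarrow> \<xi>"
  then have X: "X \<longlonglongrightarrow> \<xi>" by simp
  note [measurable_cong] = M
  have [measurable]: "h \<in> borel_measurable M"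
    using h by auto
  have "(\<lambda>n. LINT x|M. cis (- (2 * pi * (x \<bullet> X n))) * h x) \<longlonglongrightarrow> (LINT x|M. cis (- (2 * pi * (x \<bullet> \<xi>))) * h x)"
  proof (rule integral_dominated_convergence[where w = "\<lambda>x. norm (h x)"])
    show "AE x in M. (\<lambda>n. cis (- (2 * pi * (x \<bullet> X n))) * h x) \<longlonglongrightarrow> cis (- (2 * pi * (x \<bullet> \<xi>))) * h x"
      unfolding cis_conv_exp by (intro AE_I2 tendsto_intros X)
  qed (use h in \<open>auto simp: norm_mult\<close>)
  then show "(fourier M h \<circ> X) \<longlonglongrightarrow> fourier M h \<xi>"
    by (simp add: fourier_eq_cis o_def)
qed

lemma borel_measurable_fourier:
  "sets M = sets borel \<Longrightarrow> integrable M h \<Longrightarrow> fourier M h \<in> borel_measurable borel"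
  by (intro borel_measurable_continuous_onI continuous_on_fourier)

text \<open>The Gaussian mollifications of \<open>u\<close> have two limits as the width
  \<open>1 / Suc n\<close> shrinks: \<open>u x\<close> by the approximate identity, and the
  inversion integral because the damping factor in \<open>conv_gaussian_eq_fourier\<close> increases
  to 1.\<close>

theorem fourier_inversion:
  fixes u :: "'a::euclidean_space \<Rightarrow> complex"
  assumes u: "continuous_on UNIV u" "\<And>x. norm (u x) \<le> B" "integrable lborel u"
    and uh: "integrable lborel (fourier lborel u)"
  shows "u x = (LINT \<xi>|lborel. fourier lborel u \<xi> * cis (2 * pi * (x \<bullet> \<xi>)))"
proof (rule LIMSEQ_unique)
  let ?K = "\<lambda>n \<xi>::'a. exp (- (norm ((2 * pi * (1 / Suc n)) *\<^sub>R \<xi>))\<^sup>2 / 2)"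
  have [measurable]: "fourier lborel u \<in> borel_measurable borel"
    using uh by auto
  show "(\<lambda>n. conv lborel u (rescale (1 / Suc n) gaussian) x) \<longlonglongrightarrow> u x"
    using u by (intro conv_rescale_tendsto integrable_gaussian integral_gaussian)
  have "(\<lambda>n. LINT \<xi>|lborel. fourier lborel u \<xi> * cis (2 * pi * (x \<bullet> \<xi>)) * complex_of_real (?K n \<xi>))
     \<longlonglongrightarrow> (LINT \<xi>|lborel. fourier lborel u \<xi> * cis (2 * pi * (x \<bullet> \<xi>)))"
  proof (rule integral_dominated_convergence[where w = "\<lambda>\<xi>. norm (fourier lborel u \<xi>)"])
    show "AE \<xi> in lborel. (\<lambda>n. fourier lborel u \<xi> * cis (2 * pi * (x \<bullet> \<xi>)) * complex_of_real (?K n \<xi>))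
       \<longlonglongrightarrow> fourier lborel u \<xi> * cis (2 * pi * (x \<bullet> \<xi>))"
    proof (intro AE_I2)
      fix \<xi> :: 'a
      have "(\<lambda>n. 1 / real (Suc n)) \<longlonglongrightarrow> 0"
        by (rule LIMSEQ_Suc[OF lim_1_over_n])
      then have "(\<lambda>n. ?K n \<xi>) \<longlonglongrightarrow> exp (- (norm ((2 * pi * 0) *\<^sub>R \<xi>))\<^sup>2 / 2)"
        by (intro tendsto_exp tendsto_minus tendsto_divide tendsto_power tendsto_norm tendsto_scaleR tendsto_mult tendsto_const) simp_all
      then have "(\<lambda>n. fourier lborel u \<xi> * cis (2 * pi * (x \<bullet> \<xi>)) * complex_of_real (?K n \<xi>))
         \<longlonglongrightarrow> fourier lborel u \<xi> * cis (2 * pi * (x \<bullet> \<xi>)) * complex_of_real (exp (- (norm ((2 * pi * 0) *\<^sub>R \<xi>))\<^sup>2 / 2))"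
        by (intro tendsto_mult tendsto_const tendsto_of_real)
      then show "(\<lambda>n. fourier lborel u \<xi> * cis (2 * pi * (x \<bullet> \<xi>)) * complex_of_real (?K n \<xi>))
         \<longlonglongrightarrow> fourier lborel u \<xi> * cis (2 * pi * (x \<bullet> \<xi>))"
        by simp
    qed
    show "AE \<xi> in lborel. norm (fourier lborel u \<xi> * cis (2 * pi * (x \<bullet> \<xi>)) * complex_of_real (?K n \<xi>))
        \<le> norm (fourier lborel u \<xi>)" for n
      by (intro AE_I2) (auto simp: norm_mult intro!: mult_left_le)
  qed (use uh in auto)
  then show "(\<lambda>n. conv lborel u (rescale (1 / Suc n) gaussian) x)
      \<longlonglongrightarrow> (LINT \<xi>|lborel. fourier lborel u \<xi> * cis (2 * pi * (x \<bullet> \<xi>)))"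
    using u by (subst conv_gaussian_eq_fourier) (auto intro: sigma_finite_lborel)
qed

text \<open>The double integral of \<open>?F\<close> is evaluated in both orders: integrating over
  \<open>x\<close> first gives the squared modulus of the transform, integrating over
  \<open>\<xi>\<close> first gives that of \<open>u\<close> by the conjugated inversion
  formula.\<close>

theorem plancherel:
  fixes u :: "'a::euclidean_space \<Rightarrow> complex"
  assumes u: "continuous_on UNIV u" "\<And>x. norm (u x) \<le> B" "integrable lborel u"
    and uh: "integrable lborel (fourier lborel u)"
  shows "(LINT x|lborel. (norm (u x))\<^sup>2) = (LINT \<xi>|lborel. (norm (fourier lborel u \<xi>))\<^sup>2)"
proof -
  let ?U = "fourier lborel u"
  let ?F = "\<lambda>x \<xi>. u x * (cnj (?U \<xi>) * cis (- (2 * pi * (x \<bullet> \<xi>))))"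
  have [measurable]: "u \<in> borel_measurable borel" "?U \<in> borel_measurable borel"
    using u uh by auto
  have [measurable]: "cnj \<in> borel_measurable borel"
    by (intro borel_measurable_continuous_onI continuous_intros)
  have "integrable (lborel \<Otimes>\<^sub>M lborel) (\<lambda>(x, \<xi>). norm (u x) * norm (?U \<xi>))"
    using u uh by (intro integrable_pair_mult sigma_finite_lborel) auto
  then have "integrable (lborel \<Otimes>\<^sub>M lborel) (\<lambda>(x, \<xi>). ?F x \<xi>)"
    by (rule Bochner_Integration.integrable_bound) (auto simp: norm_mult)
  then have "(LINT \<xi>|lborel. LINT x|lborel. ?F x \<xi>) = (LINT x|lborel. LINT \<xi>|lborel. ?F x \<xi>)"
    by (rule lborel_pair.Fubini_integral)
  moreover have "(LINT x|lborel. ?F x \<xi>) = complex_of_real ((norm (?U \<xi>))\<^sup>2)" for \<xi>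
  proof -
    have "(LINT x|lborel. ?F x \<xi>) = (LINT x|lborel. cnj (?U \<xi>) * (cis (- (2 * pi * (x \<bullet> \<xi>))) * u x))"
      by (simp add: mult_ac)
    also have "\<dots> = cnj (?U \<xi>) * ?U \<xi>"
      unfolding fourier_eq_cis[of lborel u \<xi>] by (rule integral_mult_right_zero)
    also have "\<dots> = complex_of_real ((norm (?U \<xi>))\<^sup>2)"
      by (simp only: complex_norm_square mult.commute)
    finally show ?thesis .
  qed
  moreover have "(LINT \<xi>|lborel. ?F x \<xi>) = complex_of_real ((norm (u x))\<^sup>2)" for x
  proof -
    have "(LINT \<xi>|lborel. ?F x \<xi>) = u x * (LINT \<xi>|lborel. cnj (?U \<xi> * cis (2 * pi * (x \<bullet> \<xi>))))"
      by (subst integral_mult_right_zero[symmetric]) (simp add: cis_cnj)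
    also have "\<dots> = u x * cnj (u x)"
      using fourier_inversion[OF u uh, of x] by (simp only: Bochner_Integration.integral_cnj)
    finally show ?thesis
      by (simp only: complex_norm_square)
  qed
  ultimately have "complex_of_real (LINT \<xi>|lborel. (norm (?U \<xi>))\<^sup>2) = complex_of_real (LINT x|lborel. (norm (u x))\<^sup>2)"
    by (simp only: integral_complex_of_real)
  then show ?thesis by (simp only: of_real_eq_iff)
qed

section \<open>Decay of the Fourier transform of a smooth function\<close>

lemma smooth_continuous: "smooth g \<Longrightarrow> continuous_on UNIV g"
  unfolding smooth_def by (metis C_k.simps(1))

lemma smooth_differentiable:
  assumes "smooth g" shows "g differentiable (at x)"
  using assms unfolding smooth_def by (metis C_k.simps(2))

lemma smooth_frechet_derivative: "smooth g \<Longrightarrow> smooth (\<lambda>x. frechet_derivative g (at x) v)"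
  unfolding smooth_def by (metis C_k.simps(2))

text \<open>The complement of \<open>S\<close> is open, so \<open>g\<close> vanishes near
  \<open>x\<close>. Hence one set \<open>S\<close> serves for all iterated derivatives.\<close>

lemma frechet_derivative_eq_0_outside:
  assumes S: "closed S" "\<And>x. x \<notin> S \<Longrightarrow> g x = 0" and x: "x \<notin> S"
  shows "frechet_derivative g (at x) v = (0::real)"
proof -
  have "(g has_derivative (\<lambda>_. 0)) (at x)"
    by (rule has_derivative_transform_within_open[OF has_derivative_const open_Compl[OF S(1)]])
      (use S x in auto)
  then show ?thesis
    by (simp add: frechet_derivative_at[symmetric])
qed

section \<open>Functions with compact support and the decay of their transforms\<close>

lemma compact_support_bounded:
  fixes g :: "'a::topological_space \<Rightarrow> 'b::real_normed_vector"
  assumes "continuous_on UNIV g" "compact S" "\<And>x. x \<notin> S \<Longrightarrow> g x = 0"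
  obtains B where "0 \<le> B" "\<And>x. norm (g x) \<le> B"
proof -
  have "compact (g ` S)"
    using assms by (intro compact_continuous_image continuous_on_subset[OF assms(1)]) auto
  then obtain B where B: "\<And>x. x \<in> S \<Longrightarrow> norm (g x) \<le> B"
    using compact_imp_bounded bounded_iff by (metis imageI)
  show ?thesis
  proof (rule that)
    show "norm (g x) \<le> max 0 B" for x
      using B[of x] assms(3)[of x] by (cases "x \<in> S") auto
  qed auto
qed

lemma integrable_indicator_bounded:
  fixes S :: "'a::euclidean_space set"
  assumes "bounded S" "S \<in> sets borel"
  shows "integrable lborel (indicator S :: 'a \<Rightarrow> real)"
  using emeasure_bounded_finite[OF assms(1)] assms(2) by (intro integrable_real_indicator) auto

lemma integrable_bounded_support:
  fixes g :: "'a::euclidean_space \<Rightarrow> 'b::{banach,second_countable_topology}"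
  assumes [measurable]: "g \<in> borel_measurable borel" and B: "\<And>x. norm (g x) \<le> B"
    and S: "bounded S" "\<And>x. x \<notin> S \<Longrightarrow> g x = 0"
  shows "integrable lborel g"
proof -
  obtain r where r: "S \<subseteq> cball 0 r"
    using S(1) unfolding bounded_iff subset_eq mem_cball_0 by blast
  have int: "integrable lborel (\<lambda>x::'a. B * indicator (cball 0 r) x)"
    by (intro integrable_mult_right integrable_indicator_bounded) auto
  have "norm (g x) \<le> norm (B * indicator (cball 0 r) x)" for x
    using B[of x] S(2)[of x] subsetD[OF r, of x] by (cases "x \<in> cball 0 r") auto
  then show ?thesis
    using Bochner_Integration.integrable_bound[OF int, of g] by auto
qed

lemma integrable_continuous_compact_support:
  fixes g :: "'a::euclidean_space \<Rightarrow> 'b::{banach,second_countable_topology}"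
  assumes g: "continuous_on UNIV g" and S: "compact S" "\<And>x. x \<notin> S \<Longrightarrow> g x = 0"
  shows "integrable lborel g"
proof -
  obtain B where "\<And>x. norm (g x) \<le> B"
    using compact_support_bounded[OF assms] by blast
  then show ?thesis
    using S g compact_imp_bounded
    by (intro integrable_bounded_support[of g B S]) (auto intro: borel_measurable_continuous_onI)
qed

text \<open>Translating \<open>u\<close> by \<open>t v\<close> multiplies the transform by a character;
  differentiate this identity in \<open>t\<close> at \<open>0\<close>.\<close>
lemma fourier_frechet_derivative:
  fixes u :: "'a::euclidean_space \<Rightarrow> real"
  assumes u: "smooth u" and S: "compact S" "\<And>x. x \<notin> S \<Longrightarrow> u x = 0"
  shows "fourier lborel (\<lambda>x. complex_of_real (frechet_derivative u (at x) v)) \<xi>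
    = 2 * pi * \<i> * (v \<bullet> \<xi>) * fourier lborel (\<lambda>x. complex_of_real (u x)) \<xi>"
proof (rule LIMSEQ_unique)
  let ?D = "\<lambda>x. frechet_derivative u (at x) v"
  let ?e = "\<lambda>x. cis (- (2 * pi * (x \<bullet> \<xi>)))"
  let ?U = "fourier lborel (\<lambda>x. complex_of_real (u x)) \<xi>"
  define t where "t n = 1 / real (Suc n)" for n
  have t: "0 < t n" "t n \<le> 1" for n
    by (auto simp: t_def)
  have t0: "t \<longlonglongrightarrow> 0"
    unfolding t_def by (rule LIMSEQ_Suc[OF lim_1_over_n])
  have cont: "continuous_on UNIV u" "continuous_on UNIV ?D"
    using smooth_continuous[OF u] smooth_continuous[OF smooth_frechet_derivative[OF u]] by auto
  have [measurable]: "u \<in> borel_measurable borel" "?D \<in> borel_measurable borel"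
    using cont by (auto intro: borel_measurable_continuous_onI)
  have D0: "?D x = 0" if "x \<notin> S" for x
    using frechet_derivative_eq_0_outside[OF compact_imp_closed[OF S(1)] S(2) that] .
  obtain B where B: "0 \<le> B" "\<And>x. norm (?D x) \<le> B"
    using compact_support_bounded[OF cont(2) S(1) D0] by blast
  have deriv: "((\<lambda>s. u (x + s *\<^sub>R v)) has_real_derivative ?D (x + s *\<^sub>R v)) (at s)" for x s
  proof -
    have ud: "(u has_derivative frechet_derivative u (at (x + s *\<^sub>R v))) (at (x + s *\<^sub>R v))"
      using smooth_differentiable[OF u] frechet_derivative_works by blast
    have "((\<lambda>s. u (x + s *\<^sub>R v)) has_derivative (\<lambda>r. frechet_derivative u (at (x + s *\<^sub>R v)) (r *\<^sub>R v))) (at s)"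
      by (rule has_derivative_compose[where f = "\<lambda>s. x + s *\<^sub>R v" and g = u, OF _ ud]) (auto intro!: derivative_eq_intros)
    then show ?thesis
      using linear_frechet_derivative[OF smooth_differentiable[OF u]]
      by (simp add: has_field_derivative_def linear_cmul mult_commute_abs)
  qed
  \<comment> \<open>The mean value theorem bounds every difference quotient by the supremum of the
    directional derivative, uniformly in \<open>n\<close>.\<close>
  have bound: "norm ((u (x + t n *\<^sub>R v) - u x) / t n) \<le> B" for x n
  proof -
    obtain z where "u (x + t n *\<^sub>R v) - u (x + 0 *\<^sub>R v) = (t n - 0) * ?D (x + z *\<^sub>R v)"
      using MVT2[OF t(1)[of n], of "\<lambda>s. u (x + s *\<^sub>R v)" "\<lambda>s. ?D (x + s *\<^sub>R v)"] deriv by blast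
    then show ?thesis
      using t(1)[of n] B(2)[of "x + z *\<^sub>R v"] by simp
  qed
  obtain r where r: "S \<subseteq> cball 0 r"
    using compact_imp_bounded[OF S(1)] unfolding bounded_iff subset_eq mem_cball_0 by blast
  let ?w = "\<lambda>x::'a. B * indicator (cball 0 (r + norm v)) x"
  \<comment> \<open>Since \<open>t n \<le> 1\<close>, the translates move the support by at most
    \<open>norm v\<close>; one ball therefore contains the supports of all quotients, and
    \<open>?w\<close> is an integrable majorant.\<close>
  have supp: "(u (x + t n *\<^sub>R v) - u x) / t n = 0" if "x \<notin> cball 0 (r + norm v)" for x n
  proof -
    have "norm (t n *\<^sub>R v) \<le> norm v"
      using t[of n] by (simp add: mult_left_le_one_le)
    moreover have "r + norm v < norm x"
      using that by simp
    moreover have "norm x \<le> norm (x + t n *\<^sub>R v) + norm (t n *\<^sub>R v)"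
      by (metis add_diff_cancel norm_triangle_ineq4)
    ultimately have "r < norm x" "r < norm (x + t n *\<^sub>R v)"
      using norm_ge_zero[of v] by linarith+
    then have "x \<notin> S" "x + t n *\<^sub>R v \<notin> S"
      using r by (auto simp: subset_eq not_less[symmetric])
    then show ?thesis
      using S(2) by simp
  qed
  show "(\<lambda>n. LINT x|lborel. ?e x * complex_of_real ((u (x + t n *\<^sub>R v) - u x) / t n))
      \<longlonglongrightarrow> fourier lborel (\<lambda>x. complex_of_real (?D x)) \<xi>"
    unfolding fourier_eq_cis
  proof (rule integral_dominated_convergence[where w = ?w])
    show "integrable lborel ?w"
      by (intro integrable_mult_right integrable_indicator_bounded) auto
    show "AE x in lborel. (\<lambda>n. ?e x * complex_of_real ((u (x + t n *\<^sub>R v) - u x) / t n))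
        \<longlonglongrightarrow> ?e x * complex_of_real (?D x)"
    proof (intro AE_I2 tendsto_mult tendsto_const tendsto_of_real)
      fix x
      have "(\<lambda>s. (u (x + s *\<^sub>R v) - u x) / s) \<midarrow>0\<rightarrow> ?D x"
        using deriv[of x 0] by (simp add: DERIV_def)
      then show "(\<lambda>n. (u (x + t n *\<^sub>R v) - u x) / t n) \<longlonglongrightarrow> ?D x"
        by (rule filterlim_compose)
          (use t t0 in \<open>auto simp: filterlim_at less_imp_neq[symmetric]\<close>)
    qed
    show "AE x in lborel. norm (?e x * complex_of_real ((u (x + t n *\<^sub>R v) - u x) / t n)) \<le> ?w x" for n
    proof (intro AE_I2)
      fix x
      have "norm ((u (x + t n *\<^sub>R v) - u x) / t n) \<le> ?w x"
        using bound[of x n] supp[of x n] by (cases "x \<in> cball 0 (r + norm v)") auto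
      then show "norm (?e x * complex_of_real ((u (x + t n *\<^sub>R v) - u x) / t n)) \<le> ?w x"
        by (simp only: norm_mult norm_cis norm_of_real mult_1 real_norm_def)
    qed
  qed measurable
  have uint: "integrable lborel (\<lambda>x. ?e x * complex_of_real (u x))"
    using integrable_continuous_compact_support[OF cont(1) S]
    by (rule Bochner_Integration.integrable_bound) (auto simp: norm_mult)
  have "(LINT x|lborel. ?e x * complex_of_real ((u (x + t n *\<^sub>R v) - u x) / t n))
      = (cis (t n * (2 * pi * (v \<bullet> \<xi>))) - 1) / t n * ?U" for n
  proof -
    let ?G = "\<lambda>x. cis (t n * (2 * pi * (v \<bullet> \<xi>))) * (?e x * complex_of_real (u x))"
    have G: "integrable lborel ?G"
      using uint by (intro integrable_mult_right)
    \<comment> \<open>The translation is written in affine form with factor 1 so that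
      \<open>integral_lborel_affine\<close> removes it, leaving only the character in front.\<close>
    have shift: "?e x * complex_of_real (u (x + t n *\<^sub>R v)) = ?G (t n *\<^sub>R v + 1 *\<^sub>R x)" for x
    proof -
      have "cis (t n * (2 * pi * (v \<bullet> \<xi>))) * ?e (t n *\<^sub>R v + 1 *\<^sub>R x) = ?e x"
        by (simp add: cis_mult inner_add_left algebra_simps)
      then show ?thesis
        by (simp add: add.commute flip: mult.assoc)
    qed
    have Gs: "integrable lborel (\<lambda>x. ?G (t n *\<^sub>R v + 1 *\<^sub>R x))"
      by (subst integrable_lborel_affine[where f = ?G]) (use G in auto)
    have "(LINT x|lborel. ?e x * complex_of_real ((u (x + t n *\<^sub>R v) - u x) / t n))
        = (LINT x|lborel. (?G (t n *\<^sub>R v + 1 *\<^sub>R x) - ?e x * complex_of_real (u x)) / t n)"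
      unfolding shift[symmetric] by (simp add: right_diff_distrib)
    also have "\<dots> = ((LINT x|lborel. ?G (t n *\<^sub>R v + 1 *\<^sub>R x)) - ?U) / t n"
      unfolding fourier_eq_cis
      by (simp only: integral_divide_zero Bochner_Integration.integral_diff[OF Gs uint])
    also have "(LINT x|lborel. ?G (t n *\<^sub>R v + 1 *\<^sub>R x)) = (LINT x|lborel. ?G x)"
      by (subst integral_lborel_affine[where f = ?G]) auto
    also have "\<dots> = cis (t n * (2 * pi * (v \<bullet> \<xi>))) * ?U"
      unfolding fourier_eq_cis by (rule integral_mult_right_zero)
    finally show ?thesis
      by (simp add: left_diff_distrib)
  qed
  \<comment> \<open>This is the derivative of the character at 0, taken for a complex argument and
    then restricted to the real sequence \<open>t\<close>.\<close>
  moreover have "(\<lambda>n. (cis (t n * (2 * pi * (v \<bullet> \<xi>))) - 1) / t n) \<longlonglongrightarrow> 2 * pi * \<i> * (v \<bullet> \<xi>)"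
  proof -
    let ?c = "2 * pi * (v \<bullet> \<xi>)"
    have "((\<lambda>z. exp (z * (\<i> * ?c))) has_field_derivative (\<i> * ?c)) (at (0::complex))"
      by (auto intro!: derivative_eq_intros)
    then have "(\<lambda>z. (exp (z * (\<i> * ?c)) - 1) / z) \<midarrow>(0::complex)\<rightarrow> \<i> * ?c"
      by (simp add: DERIV_def)
    moreover have "filterlim (\<lambda>n. complex_of_real (t n)) (at 0) sequentially"
      unfolding filterlim_at using t tendsto_of_real[OF t0, where 'a = complex]
      by (auto simp: less_imp_neq[symmetric])
    ultimately have "(\<lambda>n. (exp (complex_of_real (t n) * (\<i> * ?c)) - 1) / complex_of_real (t n)) \<longlonglongrightarrow> \<i> * ?c"
      by (rule filterlim_compose)
    then show ?thesis
      by (simp add: cis_conv_exp mult_ac)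
  qed
  ultimately show "(\<lambda>n. LINT x|lborel. ?e x * complex_of_real ((u (x + t n *\<^sub>R v) - u x) / t n))
      \<longlonglongrightarrow> 2 * pi * \<i> * (v \<bullet> \<xi>) * ?U"
    by (simp only:) (intro tendsto_intros)
qed

text \<open>Two derivatives in direction \<open>b\<close> multiply the transform by
  \<open>-(2 * pi * (b \<bullet> \<xi>))\<^sup>2\<close>, so each new factor costs one application
  of the induction hypothesis to \<open>u\<close> and one to its second derivative. This is why
  \<open>u\<close> is kept arbitrary.\<close>

lemma fourier_decay:
  fixes u :: "'a::euclidean_space \<Rightarrow> real"
  assumes "finite A" "smooth u" and S: "compact S" and "\<And>x. x \<notin> S \<Longrightarrow> u x = 0"
  shows "\<exists>C. \<forall>\<xi>. (\<Prod>b\<in>A. 1 + (b \<bullet> \<xi>)\<^sup>2) * norm (fourier lborel (\<lambda>x. complex_of_real (u x)) \<xi>) \<le> C"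
  using assms(1,2,4)
proof (induction A arbitrary: u)
  case empty
  have "norm (fourier lborel (\<lambda>x. complex_of_real (u x)) \<xi>) \<le> (LINT x|lborel. norm (u x))" for \<xi>
    unfolding fourier_eq_cis by (rule order_trans[OF integral_norm_bound]) (simp add: norm_mult)
  then show ?case
    by auto
next
  case (insert b A)
  let ?D = "\<lambda>u x. frechet_derivative u (at x) b :: real"
  let ?F = "\<lambda>u. fourier lborel (\<lambda>x. complex_of_real (u x))"
  have D: "smooth (?D u)" "\<And>x. x \<notin> S \<Longrightarrow> ?D u x = 0"
    if "smooth u" "\<And>x. x \<notin> S \<Longrightarrow> u x = 0" for u
    using that compact_imp_closed[OF S]
    by (auto intro: smooth_frechet_derivative frechet_derivative_eq_0_outside)
  note u1 = D[OF insert.prems]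
  note u2 = D[OF u1]
  obtain C1 where C1: "\<And>\<xi>. (\<Prod>b\<in>A. 1 + (b \<bullet> \<xi>)\<^sup>2) * norm (?F u \<xi>) \<le> C1"
    using insert.IH[OF insert.prems] by auto
  obtain C2 where C2: "\<And>\<xi>. (\<Prod>b\<in>A. 1 + (b \<bullet> \<xi>)\<^sup>2) * norm (?F (?D (?D u)) \<xi>) \<le> C2"
    using insert.IH[OF u2] by auto
  have "(\<Prod>b\<in>insert b A. 1 + (b \<bullet> \<xi>)\<^sup>2) * norm (?F u \<xi>) \<le> C1 + C2" for \<xi>
  proof -
    let ?P = "\<Prod>b\<in>A. 1 + (b \<bullet> \<xi>)\<^sup>2"
    have P: "0 \<le> ?P"
      by (intro prod_nonneg) simp
    have "?F (?D (?D u)) \<xi> = 2 * pi * \<i> * (b \<bullet> \<xi>) * (2 * pi * \<i> * (b \<bullet> \<xi>) * ?F u \<xi>)"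
      using fourier_frechet_derivative[OF u1(1) S u1(2), of b \<xi>]
        fourier_frechet_derivative[OF insert.prems(1) S insert.prems(2), of b \<xi>] by simp
    then have "norm (?F (?D (?D u)) \<xi>) = (2 * pi)\<^sup>2 * ((b \<bullet> \<xi>)\<^sup>2 * norm (?F u \<xi>))"
      by (simp add: norm_mult power2_eq_square)
    moreover have "1 * ((b \<bullet> \<xi>)\<^sup>2 * norm (?F u \<xi>)) \<le> (2 * pi)\<^sup>2 * ((b \<bullet> \<xi>)\<^sup>2 * norm (?F u \<xi>))"
      using pi_ge_two by (intro mult_right_mono one_le_power) auto
    ultimately have "(b \<bullet> \<xi>)\<^sup>2 * norm (?F u \<xi>) \<le> norm (?F (?D (?D u)) \<xi>)"
      by simp
    then have "?P * ((b \<bullet> \<xi>)\<^sup>2 * norm (?F u \<xi>)) \<le> C2"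
      using mult_left_mono[OF _ P] C2[of \<xi>] order_trans by blast
    then show ?thesis
      using C1[of \<xi>] insert.hyps by (simp add: algebra_simps)
  qed
  then show ?case
    by blast
qed

lemma integrable_inverse_1_plus_square_lborel: "integrable lborel (\<lambda>x::real. inverse (1 + x\<^sup>2))"
  using integrable_inverse_1_plus_square by (simp add: set_integrable_def)

text \<open>\<open>fourier_decay\<close> over \<open>Basis\<close> dominates the transform by a
  product of functions \<open>1 / (1 + t\<^sup>2)\<close> of the single coordinates, which is
  integrable in every dimension.\<close>

lemma integrable_fourier_smooth:
  fixes u :: "'a::euclidean_space \<Rightarrow> real"
  assumes u: "smooth u" and S: "compact S" "\<And>x. x \<notin> S \<Longrightarrow> u x = 0"
    and [measurable]: "fourier lborel (\<lambda>x. complex_of_real (u x)) \<in> borel_measurable borel"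
  shows "integrable lborel (fourier lborel (\<lambda>x. complex_of_real (u x)))"
proof -
  let ?U = "fourier lborel (\<lambda>x. complex_of_real (u x))"
  let ?P = "\<lambda>\<xi>::'a. \<Prod>b\<in>Basis. 1 + (\<xi> \<bullet> b)\<^sup>2"
  obtain C where C: "\<And>\<xi>. ?P \<xi> * norm (?U \<xi>) \<le> C"
    using fourier_decay[OF finite_Basis u S] by (auto simp: inner_commute)
  have "integrable lborel (\<lambda>\<xi>::'a. C * (\<Prod>b\<in>Basis. inverse (1 + (\<xi> \<bullet> b)\<^sup>2)))"
    by (intro integrable_mult_right integrable_lborel_prod integrable_inverse_1_plus_square_lborel)
  then show ?thesis
  proof (rule Bochner_Integration.integrable_bound)
    show "AE \<xi> in lborel. norm (?U \<xi>) \<le> norm (C * (\<Prod>b\<in>Basis. inverse (1 + (\<xi> \<bullet> b)\<^sup>2)))"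
    proof (intro AE_I2)
      fix \<xi> :: 'a
      have P: "0 < ?P \<xi>"
        by (intro prod_pos) (auto simp: add_pos_nonneg)
      then have "norm (?U \<xi>) \<le> C / ?P \<xi>"
        using C[of \<xi>] by (simp add: field_simps)
      also have "\<dots> \<le> norm (C * (\<Prod>b\<in>Basis. inverse (1 + (\<xi> \<bullet> b)\<^sup>2)))"
        by (simp add: divide_inverse prod_inversef[symmetric] o_def)
      finally show "norm (?U \<xi>) \<le> norm (C * (\<Prod>b\<in>Basis. inverse (1 + (\<xi> \<bullet> b)\<^sup>2)))" .
    qed
  qed simp
qed

section \<open>Uniqueness of the Fourier transform of a measure\<close>

lemma
  fixes \<phi> :: "'a::euclidean_space \<Rightarrow> 'b::{banach,second_countable_topology}"
  assumes \<phi>: "integrable lborel \<phi>"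
  shows integrable_lborel_shift: "integrable lborel (\<lambda>x. \<phi> (x - y))"
    and integral_lborel_shift: "(LINT x|lborel. \<phi> (x - y)) = (LINT x|lborel. \<phi> x)"
  using integrable_lborel_affine[of 1 \<phi> "- y"] integral_lborel_affine[of 1 \<phi> "- y"] \<phi> by auto

text \<open>By translation invariance the inner integral of the modulus over \<open>x\<close> is
  \<open>norm (h y)\<close> times the \<open>L^1\<close> norm of \<open>\<phi>\<close>, and
  \<open>h\<close> is integrable.\<close>

lemma integrable_pair_conv:
  fixes h :: "'a::euclidean_space \<Rightarrow> complex"
  assumes M: "sigma_finite_measure M" "sets M = sets borel" and h: "integrable M h"
    and \<phi>: "integrable lborel \<phi>"
  shows "integrable (M \<Otimes>\<^sub>M lborel) (\<lambda>(y, x). h y * complex_of_real (\<phi> (x - y)))"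
proof -
  interpret pair_sigma_finite M lborel
    using M sigma_finite_lborel by (simp add: pair_sigma_finite_def)
  note [measurable_cong] = M(2)
  have [measurable]: "h \<in> borel_measurable M" "\<phi> \<in> borel_measurable borel"
    using h \<phi> by auto
  have "integrable lborel (\<lambda>x. norm (\<phi> x))"
    using \<phi> by (rule integrable_norm)
  note norm = integral_lborel_shift[OF this]
  show ?thesis
  proof (rule Fubini_integrable)
    show "integrable M (\<lambda>y. LINT x|lborel. norm (case (y, x) of (y, x) \<Rightarrow> h y * complex_of_real (\<phi> (x - y))))"
      using h norm by (simp add: norm_mult)
    show "AE y in M. integrable lborel (\<lambda>x. case (y, x) of (y, x) \<Rightarrow> h y * complex_of_real (\<phi> (x - y)))"
      using integrable_lborel_shift[OF \<phi>] by simp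
  qed measurable
qed

text \<open>The character splits as \<open>?e x = ?e y * ?e (x - y)\<close>; after Fubini, the inner
  integral over \<open>x\<close> is a translate of the integral defining the transform of
  \<open>\<phi>\<close>.\<close>

lemma fourier_conv:
  fixes h :: "'a::euclidean_space \<Rightarrow> complex"
  assumes M: "sigma_finite_measure M" "sets M = sets borel" and h: "integrable M h"
    and \<phi>: "integrable lborel \<phi>"
  shows "fourier lborel (conv M h \<phi>) \<xi>
    = fourier M h \<xi> * fourier lborel (\<lambda>x. complex_of_real (\<phi> x)) \<xi>"
proof -
  interpret pair_sigma_finite M lborel
    using M sigma_finite_lborel by (simp add: pair_sigma_finite_def)
  note [measurable_cong] = M(2)
  have [measurable]: "h \<in> borel_measurable M" "\<phi> \<in> borel_measurable borel"
    using h \<phi> by auto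
  let ?e = "\<lambda>x. cis (- (2 * pi * (x \<bullet> \<xi>)))"
  let ?F = "\<lambda>y x. ?e x * (h y * complex_of_real (\<phi> (x - y)))"
  let ?G = "\<lambda>x. ?e x * complex_of_real (\<phi> x)"
  have "integrable lborel (\<lambda>x. complex_of_real (\<phi> x))"
    using \<phi> by simp
  then have G: "integrable lborel ?G"
    by (rule Bochner_Integration.integrable_bound) (auto simp: norm_mult)
  have "integrable (M \<Otimes>\<^sub>M lborel) (\<lambda>(y, x). ?F y x)"
    using integrable_pair_conv[OF assms]
    by (rule Bochner_Integration.integrable_bound) (auto simp: norm_mult)
  then have "(LINT x|lborel. LINT y|M. ?F y x) = (LINT y|M. LINT x|lborel. ?F y x)"
    by (rule Fubini_integral)
  moreover have "(LINT y|M. ?F y x) = ?e x * conv M h \<phi> x" for x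
    unfolding conv_def by (rule integral_mult_right_zero)
  moreover have "(LINT x|lborel. ?F y x) = (?e y * h y) * (LINT x|lborel. ?G x)" for y
  proof -
    have e: "?e x = ?e y * ?e (x - y)" for x
      by (simp add: cis_mult algebra_simps)
    have "?F y x = (?e y * h y) * ?G (x - y)" for x
      by (subst e) (simp only: mult_ac)
    then have "(LINT x|lborel. ?F y x) = (?e y * h y) * (LINT x|lborel. ?G (x - y))"
      by (simp only: integral_mult_right_zero)
    then show ?thesis
      by (simp only: integral_lborel_shift[OF G])
  qed
  ultimately show ?thesis
    by (simp only: fourier_eq_cis integral_mult_left_zero)
qed

lemma continuous_on_conv:
  fixes h :: "'a::euclidean_space \<Rightarrow> complex"
  assumes M: "sets M = sets borel" and h: "integrable M h"
    and \<phi>: "continuous_on UNIV \<phi>" and B: "\<And>x. norm (\<phi> x) \<le> B"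
  shows "continuous_on UNIV (conv M h \<phi>)"
  unfolding continuous_on_sequentially
proof (intro allI ballI impI)
  fix X :: "nat \<Rightarrow> 'a" and x :: 'a assume "(\<forall>n. X n \<in> UNIV) \<and> X \<longlonglongrightarrow> x"
  then have X: "X \<longlonglongrightarrow> x" by simp
  note [measurable_cong] = M
  have [measurable]: "h \<in> borel_measurable M" "\<phi> \<in> borel_measurable borel"
    using h \<phi> by (auto intro: borel_measurable_continuous_onI)
  have "(\<lambda>n. LINT y|M. h y * complex_of_real (\<phi> (X n - y))) \<longlonglongrightarrow> (LINT y|M. h y * complex_of_real (\<phi> (x - y)))"
  proof (rule integral_dominated_convergence[where w = "\<lambda>y. norm (h y) * B"])
    show "AE y in M. (\<lambda>n. h y * complex_of_real (\<phi> (X n - y))) \<longlonglongrightarrow> h y * complex_of_real (\<phi> (x - y))"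
    proof (intro AE_I2 tendsto_mult tendsto_const tendsto_of_real)
      fix y
      have "isCont \<phi> (x - y)"
        using \<phi> by (simp add: continuous_on_eq_continuous_at)
      moreover have "(\<lambda>n. X n - y) \<longlonglongrightarrow> x - y"
        by (intro tendsto_intros X)
      ultimately show "(\<lambda>n. \<phi> (X n - y)) \<longlonglongrightarrow> \<phi> (x - y)"
        by (rule isCont_tendsto_compose)
    qed
    show "AE y in M. norm (h y * complex_of_real (\<phi> (X n - y))) \<le> norm (h y) * B" for n
      using B by (intro AE_I2) (auto simp: norm_mult intro!: mult_left_mono)
  qed (use h in auto)
  then show "(conv M h \<phi> \<circ> X) \<longlonglongrightarrow> conv M h \<phi> x"
    by (simp add: conv_def o_def)
qed

text \<open>The kernel is nonnegative with mass 1, so averaging preserves the bound. This is the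
  majorant, uniform in \<open>n\<close>, for \<open>integral_continuous_eq_0\<close>.\<close>

lemma norm_conv_rescale_gaussian_le:
  fixes w :: "'a::euclidean_space \<Rightarrow> complex"
  assumes \<delta>: "0 < \<delta>" and [measurable]: "w \<in> borel_measurable borel" and B: "\<And>x. norm (w x) \<le> B"
  shows "norm (conv lborel w (rescale \<delta> gaussian) x) \<le> B"
proof -
  have nonneg: "0 \<le> gaussian z" for z :: 'a
    by (simp add: gaussian_eq)
  have int: "integrable lborel (\<lambda>z::'a. B * gaussian z)"
    by (intro integrable_mult_right integrable_gaussian)
  have le: "norm (w (x - \<delta> *\<^sub>R z) * complex_of_real (gaussian z)) \<le> B * gaussian z" for z
    using B[of "x - \<delta> *\<^sub>R z"] nonneg[of z] by (auto simp: norm_mult intro!: mult_right_mono)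
  have "norm (conv lborel w (rescale \<delta> gaussian) x) \<le> (LINT z::'a|lborel. B * gaussian z)"
    unfolding conv_lborel_rescale[OF \<delta> assms(2) gaussian_measurable]
  proof (rule Bochner_Integration.integral_norm_bound_integral[OF _ int])
    show "integrable lborel (\<lambda>z. w (x - \<delta> *\<^sub>R z) * complex_of_real (gaussian z))"
      using int
    proof (rule Bochner_Integration.integrable_bound)
      show "AE z in lborel. norm (w (x - \<delta> *\<^sub>R z) * complex_of_real (gaussian z)) \<le> norm (B * gaussian z)"
        using le by (intro AE_I2) (metis abs_ge_self order_trans real_norm_def)
    qed measurable
  qed (rule le)
  then show ?thesis
    by (simp add: integral_gaussian)
qed

text \<open>Replace \<open>w\<close> by its Gaussian mollifications. Fubini moves the kernel onto
  \<open>h dM\<close>, whose mollification is zero because it is computed from the vanishing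
  transform.\<close>

lemma integral_continuous_eq_0:
  fixes h :: "'a::euclidean_space \<Rightarrow> complex"
  assumes M: "sigma_finite_measure M" "sets M = sets borel" and h: "integrable M h"
    and zero: "\<And>\<xi>. fourier M h \<xi> = 0"
    and w: "continuous_on UNIV w" "\<And>x. norm (w x) \<le> B"
  shows "(LINT y|M. h y * w y) = 0"
proof (rule LIMSEQ_unique)
  interpret pair_sigma_finite M lborel
    using M sigma_finite_lborel by (simp add: pair_sigma_finite_def)
  note [measurable_cong] = M(2)
  have [measurable]: "h \<in> borel_measurable M" "w \<in> borel_measurable borel"
    using h w by (auto intro: borel_measurable_continuous_onI)
  let ?\<kappa> = "\<lambda>n::nat. rescale (1 / Suc n) (gaussian :: 'a \<Rightarrow> real)"
  let ?c = "\<lambda>n. conv lborel w (?\<kappa> n)"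
  have [measurable]: "?c n \<in> borel_measurable M" for n
    unfolding conv_def by measurable
  show "(\<lambda>n. LINT y|M. h y * ?c n y) \<longlonglongrightarrow> (LINT y|M. h y * w y)"
  proof (rule integral_dominated_convergence[where w = "\<lambda>y. norm (h y) * B"])
    show "AE y in M. (\<lambda>n. h y * ?c n y) \<longlonglongrightarrow> h y * w y"
      by (intro AE_I2 tendsto_mult tendsto_const conv_rescale_tendsto[where B = B] w integrable_gaussian integral_gaussian)
    show "AE y in M. norm (h y * ?c n y) \<le> norm (h y) * B" for n
    proof (intro AE_I2)
      show "norm (h y * ?c n y) \<le> norm (h y) * B" for y
        using norm_conv_rescale_gaussian_le[of "1 / Suc n" w B y] w(2)
        by (auto simp: norm_mult intro!: mult_left_mono)
    qed
  qed (use h in \<open>auto simp del: of_nat_Suc\<close>)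
  have "(LINT y|M. h y * ?c n y) = 0" for n
  proof -
    let ?F = "\<lambda>y x. w x * (h y * complex_of_real (?\<kappa> n (x - y)))"
    have "integrable (M \<Otimes>\<^sub>M lborel) (\<lambda>p. B *\<^sub>R (case p of (y, x) \<Rightarrow> h y * complex_of_real (?\<kappa> n (x - y))))"
      by (intro integrable_scaleR_right integrable_pair_conv M h integrable_rescale integrable_gaussian) auto
    then have "integrable (M \<Otimes>\<^sub>M lborel) (\<lambda>(y, x). ?F y x)"
    proof (rule Bochner_Integration.integrable_bound)
      show "AE p in M \<Otimes>\<^sub>M lborel. norm (case p of (y, x) \<Rightarrow> ?F y x)
          \<le> norm (B *\<^sub>R (case p of (y, x) \<Rightarrow> h y * complex_of_real (?\<kappa> n (x - y))))"
        using w(2) by (intro AE_I2) (auto simp: norm_mult intro!: mult_right_mono order_trans[OF w(2) abs_ge_self])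
    qed measurable
    then have "(LINT x|lborel. LINT y|M. ?F y x) = (LINT y|M. LINT x|lborel. ?F y x)"
      by (rule Fubini_integral)
    moreover have "(LINT y|M. ?F y x) = w x * conv M h (?\<kappa> n) x" for x
      unfolding conv_def by (rule integral_mult_right_zero)
    moreover have "conv M h (?\<kappa> n) x = 0" for x
      using conv_gaussian_eq_fourier[OF M h, of "1 / Suc n" x] by (simp add: zero)
    moreover have "(LINT x|lborel. ?F y x) = h y * ?c n y" for y
    proof -
      \<comment> \<open>Evenness of the kernel is what allows it to be read as acting on
        \<open>w\<close> as well as on \<open>h dM\<close>.\<close>
      have "?\<kappa> n (x - y) = ?\<kappa> n (y - x)" for x
        using gaussian_minus[of "(y - x) /\<^sub>R (1 / Suc n)"]
        by (simp add: rescale_def scaleR_diff_right del: of_nat_Suc)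
      then have "?F y x = h y * (w x * complex_of_real (?\<kappa> n (y - x)))" for x
        by (simp only: mult_ac)
      then show ?thesis
        unfolding conv_def by (simp only: integral_mult_right_zero)
    qed
    ultimately show ?thesis
      by (simp only: mult_zero_right Bochner_Integration.integral_zero)
  qed
  then show "(\<lambda>n. LINT y|M. h y * ?c n y) \<longlonglongrightarrow> 0"
    by simp
qed

text \<open>The indicator of \<open>C\<close> is the pointwise limit of the bounded continuous
  functions \<open>?w n\<close>, to each of which \<open>integral_continuous_eq_0\<close>
  applies.\<close>

lemma integral_closed_eq_0:
  fixes h :: "'a::euclidean_space \<Rightarrow> complex"
  assumes M: "sigma_finite_measure M" "sets M = sets borel" and h: "integrable M h"
    and zero: "\<And>\<xi>. fourier M h \<xi> = 0" and C: "closed C"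
  shows "(LINT x:C|M. h x) = 0"
\<comment> \<open>By convention \<open>infdist x {} = 0\<close>, so for empty \<open>C\<close> the
  functions \<open>?w n\<close> would be constantly 1; this case is separate.\<close>
proof (cases "C = {}")
  case False
  let ?w = "\<lambda>n x. max 0 (1 - real n * infdist x C)"
  note [measurable_cong] = M(2)
  have [measurable]: "h \<in> borel_measurable M" "C \<in> sets borel"
    using h C by auto
  have cont: "continuous_on UNIV (?w n)" for n
    by (intro continuous_intros)
  have w1: "norm (?w n x) \<le> 1" for n x
    using infdist_nonneg[of x C] by auto
  have [measurable]: "?w n \<in> borel_measurable borel" for n
    by (intro borel_measurable_continuous_onI cont)
  have lim: "(\<lambda>n. ?w n x) \<longlonglongrightarrow> indicator C x" for x
  proof (cases "x \<in> C")
    case False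
    then have pos: "0 < infdist x C"
      using C \<open>C \<noteq> {}\<close> infdist_pos_not_in_closed by blast
    have "eventually (\<lambda>n. 1 / infdist x C \<le> real n) sequentially"
      using eventually_ge_at_top[of "nat \<lceil>1 / infdist x C\<rceil>"]
      by eventually_elim linarith
    then have "eventually (\<lambda>n. ?w n x = 0) sequentially"
      by eventually_elim (use pos in \<open>simp add: field_simps max_def\<close>)
    then show ?thesis
      using False by (simp add: tendsto_eventually)
  qed simp
  have "(\<lambda>n. LINT x|M. h x * complex_of_real (?w n x)) \<longlonglongrightarrow> (LINT x|M. h x * complex_of_real (indicator C x))"
  proof (rule integral_dominated_convergence[where w = "\<lambda>x. norm (h x)"])
    show "AE x in M. (\<lambda>n. h x * complex_of_real (?w n x)) \<longlonglongrightarrow> h x * complex_of_real (indicator C x)"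
      by (intro AE_I2 tendsto_mult tendsto_const tendsto_of_real lim)
    show "AE x in M. norm (h x * complex_of_real (?w n x)) \<le> norm (h x)" for n
      using w1[of n] by (intro AE_I2) (auto simp: norm_mult intro!: mult_left_le)
  qed (use h in auto)
  moreover have "(LINT x|M. h x * complex_of_real (?w n x)) = 0" for n
    using w1 by (intro integral_continuous_eq_0[OF M h zero, where B = 1] continuous_intros cont) auto
  ultimately have "(LINT x|M. h x * complex_of_real (indicator C x)) = 0"
    by (simp add: LIMSEQ_const_iff)
  then show ?thesis
    by (simp add: set_lebesgue_integral_def scaleR_conv_of_real mult.commute)
qed (simp add: set_lebesgue_integral_def)

text \<open>Dynkin's argument: the sets on which \<open>h\<close> integrates to zero include the
  closed sets, an intersection-stable generator of the Borel sets, and are closed under complements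
  and countable disjoint unions.\<close>

theorem fourier_eq_0_imp_AE_eq_0:
  fixes h :: "'a::euclidean_space \<Rightarrow> complex"
  assumes M: "sigma_finite_measure M" "sets M = sets borel" and h: "integrable M h"
    and zero: "\<And>\<xi>. fourier M h \<xi> = 0"
  shows "AE x in M. h x = 0"
proof (rule sigma_finite_measure.density_zero[OF M(1) h])
  fix A assume "A \<in> sets M"
  then have "A \<in> sigma_sets UNIV (Collect closed)"
    by (simp add: M(2) borel_eq_closed)
  have sets: "A \<in> sets M" if "A \<in> sigma_sets UNIV (Collect closed)" for A
    using that by (simp add: M(2) borel_eq_closed)
  have set_int: "set_integrable M A h" if "A \<in> sets M" for A
    using h that unfolding set_integrable_def by (rule integrable_mult_indicator[rotated])
  have "Int_stable (Collect (closed :: 'a set \<Rightarrow> bool))"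
    by (auto simp: Int_stable_def)
  moreover have "Collect (closed :: 'a set \<Rightarrow> bool) \<subseteq> Pow UNIV"
    by simp
  ultimately show "(LINT x:A|M. h x) = 0"
    using \<open>A \<in> sigma_sets UNIV (Collect closed)\<close>
  proof (induction rule: sigma_sets_induct_disjoint)
    case (basic A)
    then show ?case
      using integral_closed_eq_0[OF M h zero] by simp
  next
    case (compl A)
    have "space M = UNIV"
      using sets_eq_imp_space_eq[OF M(2)] by simp
    then have A: "A \<in> sets M" "UNIV - A \<in> sets M"
      using sets[OF compl(1)] sets.compl_sets[of A M] by auto
    have "(LINT x:(UNIV - A) \<union> A|M. h x) = (LINT x:UNIV - A|M. h x) + (LINT x:A|M. h x)"
      by (rule set_integral_Un[OF _ set_int[OF A(2)] set_int[OF A(1)]]) auto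
    then show ?case
      using compl integral_closed_eq_0[OF M h zero closed_UNIV] by simp
  next
    case (union A)
    have A: "A i \<in> sets M" for i
      using union sets by blast
    have "(LINT x:(\<Union>i. A i)|M. h x) = (\<Sum>i. (LINT x:(A i)|M. h x))"
      using union(1) by (intro lebesgue_integral_countable_add A set_int sets.countable_UN)
        (auto simp: disjoint_family_on_def A)
    then show ?case
      using union by simp
  qed (simp add: set_lebesgue_integral_def)
qed

section \<open>Zeros of the transform of a compactly supported function\<close>

text \<open>Compact support allows the real parameter \<open>t\<close> in the exponential to become
  complex. Differentiation under the integral over a box containing \<open>S\<close> shows that the
  extension is entire, so one-variable complex analysis applies along each line.\<close>

lemma fourier_line_holomorphic:
  fixes \<phi> :: "'a::euclidean_space \<Rightarrow> complex"
  assumes \<phi>: "continuous_on UNIV \<phi>" and S: "compact S" "\<And>x. x \<notin> S \<Longrightarrow> \<phi> x = 0"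
  obtains F where "F holomorphic_on UNIV" "\<And>t. F (complex_of_real t) = fourier lborel \<phi> (t *\<^sub>R \<xi>)"
proof -
  obtain a b where ab: "S \<subseteq> cbox a b"
    using bounded_subset_cbox_symmetric[OF compact_imp_bounded[OF S(1)]] by blast
  define c where "c x = - (2 * pi * (x \<bullet> \<xi>)) * \<i>" for x
  let ?f = "\<lambda>z x. exp (c x * z) * \<phi> x"
  have c: "continuous_on A c" for A
    unfolding c_def by (intro continuous_intros)
  have \<phi>': "continuous_on A \<phi>" for A
    using \<phi> continuous_on_subset by blast
  show ?thesis
  proof (rule that[of "\<lambda>z. integral (cbox a b) (?f z)"])
    show "(\<lambda>z. integral (cbox a b) (?f z)) holomorphic_on UNIV"
    proof (rule leibniz_rule_holomorphic)
      show "((\<lambda>z. ?f z x) has_field_derivative c x * exp (c x * z) * \<phi> x) (at z within UNIV)" for z x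
        by (auto intro!: derivative_eq_intros)
      show "?f z integrable_on cbox a b" for z
        by (intro integrable_continuous continuous_intros c \<phi>')
      have "continuous_on (UNIV \<times> cbox a b) (\<lambda>p::complex \<times> 'a. c (snd p))"
        by (rule continuous_on_compose2[OF c[of UNIV]]) (auto intro: continuous_intros)
      moreover have "continuous_on (UNIV \<times> cbox a b) (\<lambda>p::complex \<times> 'a. \<phi> (snd p))"
        by (rule continuous_on_compose2[OF \<phi>]) (auto intro: continuous_intros)
      ultimately show "continuous_on (UNIV \<times> cbox a b) (\<lambda>(z, x). c x * exp (c x * z) * \<phi> x)"
        unfolding case_prod_unfold by (intro continuous_intros)
    qed auto
    show "integral (cbox a b) (?f (complex_of_real t)) = fourier lborel \<phi> (t *\<^sub>R \<xi>)" for t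
    proof -
      let ?g = "\<lambda>x. cis (- (2 * pi * (x \<bullet> (t *\<^sub>R \<xi>)))) * \<phi> x"
      have "integrable lborel ?g"
        using S by (intro integrable_continuous_compact_support[of _ S] continuous_intros \<phi>) auto
      then have "fourier lborel \<phi> (t *\<^sub>R \<xi>) = integral UNIV ?g"
        unfolding fourier_eq_cis by (rule integral_lborel[symmetric])
      also have "\<dots> = integral UNIV (\<lambda>x. if x \<in> cbox a b then ?g x else 0)"
        using ab S(2) by (intro arg_cong[where f = "integral UNIV"] ext) auto
      also have "\<dots> = integral (cbox a b) ?g"
        by (rule integral_restrict_UNIV)
      also have "?g = ?f (complex_of_real t)"
        by (auto simp: c_def cis_conv_exp mult_ac)
      finally show ?thesis ..
    qed
  qed
qed

text \<open>If \<open>\<nu> \<xi> \<noteq> 0\<close>, then \<open>F\<close> vanishes at 1 but not at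
  0, so its zero at 1 is isolated. Hence \<open>\<nu> (t *\<^sub>R \<xi>)\<close> vanishes for
  \<open>t \<noteq> 1\<close> near 1, and continuity forces \<open>\<nu> \<xi> = 0\<close>.\<close>

lemma mult_fourier_eq_0_imp_eq_0:
  fixes \<phi> :: "'a::euclidean_space \<Rightarrow> complex" and \<nu> :: "'a \<Rightarrow> complex"
  assumes \<phi>: "continuous_on UNIV \<phi>" and S: "compact S" "\<And>x. x \<notin> S \<Longrightarrow> \<phi> x = 0"
    and nonzero: "(LINT x|lborel. \<phi> x) \<noteq> 0"
    and \<nu>: "continuous_on UNIV \<nu>" and zero: "\<And>\<xi>. \<nu> \<xi> * fourier lborel \<phi> \<xi> = 0"
  shows "\<nu> \<xi> = 0"
proof (rule ccontr)
  assume \<nu>\<xi>: "\<nu> \<xi> \<noteq> 0"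
  obtain F where F: "F holomorphic_on UNIV" "\<And>t. F (complex_of_real t) = fourier lborel \<phi> (t *\<^sub>R \<xi>)"
    using fourier_line_holomorphic[OF \<phi> S] by blast
  have "F 0 \<noteq> 0"
    using F(2)[of 0] nonzero by (simp add: fourier_eq_cis)
  moreover have "F 1 = 0"
    using F(2)[of 1] zero[of \<xi>] \<nu>\<xi> by simp
  ultimately obtain r where r: "0 < r" "\<And>z. z \<in> ball 1 r - {1} \<Longrightarrow> F z \<noteq> 0"
    using isolated_zeros[OF F(1), of 1 0] by auto
  have "eventually (\<lambda>t::real. dist t 1 < r) (at 1)"
    unfolding eventually_at using r(1) by auto
  moreover have "eventually (\<lambda>t::real. t \<noteq> 1) (at 1)"
    by (simp add: eventually_at_filter)
  ultimately have "eventually (\<lambda>t::real. \<nu> (t *\<^sub>R \<xi>) = 0) (at 1)"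
  proof eventually_elim
    case (elim t)
    have "F (complex_of_real t) \<noteq> 0"
    proof (rule r(2))
      have "dist 1 (complex_of_real t) = dist t 1"
        by (metis dist_commute dist_of_real of_real_1)
      then show "complex_of_real t \<in> ball 1 r - {1}"
        using elim by simp
    qed
    then show ?case
      using zero[of "t *\<^sub>R \<xi>"] F(2)[of t] by simp
  qed
  then have "((\<lambda>t::real. \<nu> (t *\<^sub>R \<xi>)) \<longlongrightarrow> 0) (at 1)"
    by (rule tendsto_eventually)
  moreover have "((\<lambda>t::real. \<nu> (t *\<^sub>R \<xi>)) \<longlongrightarrow> \<nu> (1 *\<^sub>R \<xi>)) (at 1)"
  proof (rule isCont_tendsto_compose[of _ \<nu>])
    show "isCont \<nu> (1 *\<^sub>R \<xi>)"
      using \<nu> by (simp add: continuous_on_eq_continuous_at)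
  qed (intro tendsto_intros)
  ultimately show False
    using \<nu>\<xi> tendsto_unique[OF at_neq_bot] by fastforce
qed

section \<open>The inequality\<close>

text \<open>Cauchy-Schwarz for \<open>norm (g x)\<close> and the indicator of \<open>E\<close>,
  obtained from the nonnegativity of a quadratic polynomial in \<open>c\<close>.\<close>

lemma power2_integral_norm_le:
  fixes g :: "'a \<Rightarrow> 'b::{banach,second_countable_topology}"
  assumes g: "integrable M g" "integrable M (\<lambda>x. (norm (g x))\<^sup>2)"
    and E: "E \<in> sets M" "emeasure M E < \<infinity>" "\<And>x. x \<notin> E \<Longrightarrow> g x = 0"
  shows "(LINT x|M. norm (g x))\<^sup>2 \<le> measure M E * (LINT x|M. (norm (g x))\<^sup>2)"
proof -
  let ?I = "LINT x|M. norm (g x)" and ?B = "LINT x|M. (norm (g x))\<^sup>2" and ?m = "measure M E"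
  have quad: "0 \<le> ?B - 2 * c * ?I + c\<^sup>2 * ?m" for c
  proof -
    have i: "integrable M (\<lambda>x. norm (g x))" "integrable M (\<lambda>x. indicator E x :: real)"
      using g E by (auto intro: integrable_norm integrable_real_indicator)
    have "0 \<le> (LINT x|M. (norm (g x) - c * indicator E x)\<^sup>2)"
      by (intro Bochner_Integration.integral_nonneg) auto
    also have "\<dots> = (LINT x|M. (norm (g x))\<^sup>2 - (2 * c) * norm (g x) + c\<^sup>2 * indicator E x)"
      using E(3) by (intro Bochner_Integration.integral_cong refl)
        (auto simp: indicator_def power2_eq_square algebra_simps)
    also have "\<dots> = ?B - 2 * c * ?I + c\<^sup>2 * ?m"
      using g(2) i E by simp
    finally show ?thesis .
  qed
  show ?thesis
  proof (cases "?m = 0")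
    case True
    have "?I = 0"
    proof (rule ccontr)
      assume "?I \<noteq> 0"
      then show False
        \<comment> \<open>With \<open>?m = 0\<close> the polynomial is affine in \<open>c\<close>;
          this choice of \<open>c\<close> makes its value -1.\<close>
        using quad[of "(?B + 1) / (2 * ?I)"] True by (simp add: field_simps)
    qed
    then show ?thesis
      using True by simp
  next
    case False
    then have "0 < ?m"
      using zero_less_measure_iff by blast
    then show ?thesis
      \<comment> \<open>\<open>?I / ?m\<close> is the minimiser of the quadratic.\<close>
      using quad[of "?I / ?m"] by (simp add: field_simps power2_eq_square)
  qed
qed

lemma integral_fourier_squared_le:
  fixes g :: "'a::euclidean_space \<Rightarrow> complex"
  assumes g: "continuous_on UNIV g" and E: "E \<in> sets borel" "bounded E" "\<And>x. x \<notin> E \<Longrightarrow> g x = 0"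
    and gh: "integrable lborel (fourier lborel g)"
  shows "(LINT \<xi>|lborel. (norm (fourier lborel g \<xi>))\<^sup>2)
    \<le> measure lborel E * (LINT \<xi>|lborel. norm (fourier lborel g \<xi>))\<^sup>2"
proof -
  let ?G = "fourier lborel g"
  let ?A = "LINT \<xi>|lborel. norm (?G \<xi>)" and ?B = "LINT \<xi>|lborel. (norm (?G \<xi>))\<^sup>2"
    and ?I = "LINT x|lborel. norm (g x)" and ?m = "measure lborel E"
  have S: "compact (closure E)" "\<And>x. x \<notin> closure E \<Longrightarrow> g x = 0"
    using E closure_subset by (auto simp: compact_closure)
  obtain C where C: "\<And>x. norm (g x) \<le> C"
    using compact_support_bounded[OF g S] by blast
  have int: "integrable lborel g" "integrable lborel (\<lambda>x. (norm (g x))\<^sup>2)"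
    using S by (auto intro!: integrable_continuous_compact_support[of _ "closure E"] continuous_intros g)
  have pl: "(LINT x|lborel. (norm (g x))\<^sup>2) = ?B"
    by (rule plancherel[OF g C int(1) gh])
  have Em: "emeasure lborel E < \<infinity>"
    using emeasure_bounded_finite[OF E(2)] by simp
  have I: "?I\<^sup>2 \<le> ?m * ?B"
    using power2_integral_norm_le[OF int _ Em E(3)] E(1) pl by simp
  have "?B \<le> ?I * ?A"
  proof -
    have "(norm (?G \<xi>))\<^sup>2 \<le> ?I * norm (?G \<xi>)" for \<xi>
      unfolding power2_eq_square using norm_fourier_le[OF int(1)] by (intro mult_right_mono) auto
    moreover have "integrable lborel (\<lambda>\<xi>. ?I * norm (?G \<xi>))"
      using gh by (intro integrable_mult_right integrable_norm)
    ultimately have "?B \<le> (LINT \<xi>|lborel. ?I * norm (?G \<xi>))"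
      by (intro integral_mono') auto
    then show ?thesis
      by simp
  qed
  \<comment> \<open>Squaring makes the Cauchy-Schwarz bound on \<open>?I\<^sup>2\<close> applicable.
    One factor \<open>?B\<close> then cancels; if \<open>?B = 0\<close> the claim is
    trivial.\<close>
  then have "?B\<^sup>2 \<le> ?I\<^sup>2 * ?A\<^sup>2"
    by (metis power_mono power_mult_distrib Bochner_Integration.integral_nonneg zero_le_power2)
  also have "\<dots> \<le> (?m * ?B) * ?A\<^sup>2"
    by (intro mult_right_mono I) auto
  finally have "?B * ?B \<le> (?m * ?A\<^sup>2) * ?B"
    by (simp add: power2_eq_square mult_ac)
  moreover have "0 \<le> ?B"
    by (intro Bochner_Integration.integral_nonneg) auto
  ultimately show ?thesis
    by (cases "?B = 0") auto
qed

text \<open>The complement of the support is a union of possibly uncountably many open sets;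
  Lindelof's theorem selects countably many, and the exceptional null sets can be united.\<close>

lemma AE_function_support:
  fixes M :: "'a::second_countable_topology measure"
  shows "AE x in M. x \<notin> function_support M f \<longrightarrow> f x = 0"
proof -
  let ?\<F> = "{U. open U \<and> (AE x in M. x \<in> U \<longrightarrow> f x = 0)}"
  obtain \<G> where \<G>: "\<G> \<subseteq> ?\<F>" "countable \<G>" "\<Union>\<G> = \<Union>?\<F>"
    using Lindelof[of ?\<F>] by auto
  have "AE x in M. \<forall>U\<in>\<G>. x \<in> U \<longrightarrow> f x = 0"
    unfolding AE_ball_countable[OF \<G>(2)] using \<G>(1) by blast
  then show ?thesis
  proof eventually_elim
    case (elim x)
    then show ?case
      using \<G>(3) unfolding function_support_def by blast
  qed
qed

text \<open>On an open null set every function vanishes almost everywhere. With compactness of the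
  support of the measure this bounds the neighborhood in the main inequality.\<close>

lemma function_support_subset:
  fixes M :: "'a::topological_space measure"
  assumes M: "sets M = sets borel"
  shows "function_support M f \<subseteq> measure_support M"
proof
  fix x assume x: "x \<in> function_support M f"
  show "x \<in> measure_support M"
    unfolding measure_support_def
  proof (intro CollectI allI impI notI)
    fix U assume U: "open U \<and> x \<in> U" and "emeasure M U = 0"
    then have "U \<in> null_sets M"
      using M by auto
    then have "AE y in M. y \<notin> U"
      by (rule AE_not_in)
    then have "AE y in M. y \<in> U \<longrightarrow> f y = 0"
      by eventually_elim simp
    then show False
      using x U unfolding function_support_def by blast
  qed
qed

text \<open>For \<open>y\<close> in the support, \<open>x - y\<close> has norm at least
  \<open>r\<close> and the kernel vanishes; for almost every other \<open>y\<close>,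
  \<open>f y = 0\<close>. The kernel must vanish on the sphere of radius \<open>r\<close> too, since
  \<open>neighborhood\<close> uses open balls.\<close>

lemma conv_eq_0_outside:
  fixes M :: "'a::euclidean_space measure"
  assumes \<phi>: "\<And>z. r \<le> norm z \<Longrightarrow> \<phi> z = 0" and x: "x \<notin> neighborhood r (function_support M f)"
  shows "conv M f \<phi> x = 0"
  unfolding conv_def
proof (rule integral_eq_zero_AE)
  show "AE y in M. f y * complex_of_real (\<phi> (x - y)) = 0"
    using AE_function_support[of M f]
  proof eventually_elim
    case (elim y)
    then show ?case
      using x \<phi>[of "x - y"] by (auto simp: neighborhood_def dist_norm norm_minus_commute not_less)
  qed
qed

text \<open>\<open>\<mu>\<close> need not be \<open>\<sigma>\<close>-finite, but only the finite measure \<open>f d\<mu>\<close> matters.\<close>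
lemma finite_measure_polar:
  fixes \<mu> :: "'a::euclidean_space measure"
  assumes \<mu>: "sets \<mu> = sets borel" and f: "integrable \<mu> f"
  obtains M h where "sigma_finite_measure M" "sets M = sets borel" "integrable M h"
    "\<And>\<phi>. \<phi> \<in> borel_measurable borel \<Longrightarrow> conv \<mu> f \<phi> = conv M h \<phi>"
    "(AE x in M. h x = 0) \<Longrightarrow> (AE x in \<mu>. f x = (0::complex))"
proof -
  \<comment> \<open>Polar decomposition: \<open>f d\<mu>\<close> equals \<open>sgn f\<close> times
    the measure with density \<open>norm (f x)\<close>, which is finite because \<open>f\<close> is
    integrable.\<close>
  let ?M = "density \<mu> (\<lambda>x. norm (f x))"
  note [measurable_cong] = \<mu>
  have [measurable]: "f \<in> borel_measurable \<mu>"
    using f by auto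
  have [measurable]: "(sgn :: complex \<Rightarrow> complex) \<in> borel_measurable borel"
    unfolding sgn_div_norm[abs_def] by measurable
  have polar: "norm z *\<^sub>R sgn z = z" for z :: complex
    by (cases "z = 0") (simp_all add: sgn_div_norm)
  show ?thesis
  proof (rule that[of ?M "\<lambda>x. sgn (f x)"])
    show "sets ?M = sets borel"
      using \<mu> by simp
    have "emeasure ?M (space ?M) = (\<integral>\<^sup>+x. norm (f x) \<partial>\<mu>)"
      by (subst emeasure_density) (auto intro!: nn_integral_cong simp: indicator_def)
    also have "\<dots> < \<infinity>"
      using f by (simp add: integrable_iff_bounded)
    finally have "finite_measure ?M"
      by (intro finite_measureI) simp
    then show "sigma_finite_measure ?M"
      by (simp add: finite_measure_def)
    show "integrable ?M (\<lambda>x. sgn (f x))"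
      using f by (subst integrable_density) (auto simp: polar)
    show "conv \<mu> f \<phi> = conv ?M (\<lambda>x. sgn (f x)) \<phi>" if [measurable]: "\<phi> \<in> borel_measurable borel" for \<phi>
    proof
      show "conv \<mu> f \<phi> x = conv ?M (\<lambda>x. sgn (f x)) \<phi> x" for x
        unfolding conv_def by (subst integral_density) (auto simp: polar simp flip: mult_scaleR_left)
    qed
    assume "AE x in ?M. sgn (f x) = 0"
    then show "AE x in \<mu>. f x = 0"
      by (subst (asm) AE_density) (auto simp: sgn_zero_iff)
  qed
qed

text \<open>The normalisation of \<open>rescale\<close> cancels the Jacobian of
  \<open>x -> \<delta> x\<close>. This carries integrability of the transform, and its value at the
  origin, from \<open>\<psi>\<close> to the rescaled kernel.\<close>

lemma fourier_rescale:
  fixes \<psi> :: "'a::euclidean_space \<Rightarrow> real"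
  assumes \<delta>: "0 < \<delta>" and [measurable]: "\<psi> \<in> borel_measurable borel"
  shows "fourier lborel (\<lambda>x. complex_of_real (rescale \<delta> \<psi> x)) \<xi>
    = fourier lborel (\<lambda>x. complex_of_real (\<psi> x)) (\<delta> *\<^sub>R \<xi>)"
proof -
  let ?g = "\<lambda>x. cis (- (2 * pi * (x \<bullet> \<xi>))) * complex_of_real (rescale \<delta> \<psi> x)"
  have "?g (0 + \<delta> *\<^sub>R x) = (cis (- (2 * pi * (x \<bullet> (\<delta> *\<^sub>R \<xi>)))) * complex_of_real (\<psi> x)) /\<^sub>R \<delta> ^ DIM('a)" for x
    using \<delta> by (simp add: rescale_def scaleR_conv_of_real divide_inverse)
  then have "(LINT x|lborel. ?g (0 + \<delta> *\<^sub>R x)) = fourier lborel (\<lambda>x. complex_of_real (\<psi> x)) (\<delta> *\<^sub>R \<xi>) /\<^sub>R \<delta> ^ DIM('a)"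
    unfolding fourier_eq_cis by (simp only: integral_scaleR_right)
  moreover have "(LINT x|lborel. ?g (0 + \<delta> *\<^sub>R x)) = fourier lborel (\<lambda>x. complex_of_real (rescale \<delta> \<psi> x)) \<xi> /\<^sub>R \<delta> ^ DIM('a)"
    unfolding fourier_eq_cis using \<delta> by (subst integral_lborel_affine[where f = ?g]) auto
  ultimately show ?thesis
    using \<delta> by simp
qed

text \<open>Going back through Plancherel gives \<open>g = 0\<close> almost everywhere, so the
  transform vanishes at every point and not just almost everywhere.\<close>

lemma fourier_eq_0_if_integral_squared_eq_0:
  fixes g :: "'a::euclidean_space \<Rightarrow> complex"
  assumes g: "continuous_on UNIV g" and S: "compact S" "\<And>x. x \<notin> S \<Longrightarrow> g x = 0"
    and gh: "integrable lborel (fourier lborel g)"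
    and zero: "(LINT \<xi>|lborel. (norm (fourier lborel g \<xi>))\<^sup>2) = 0"
  shows "fourier lborel g \<xi> = 0"
proof -
  obtain C where C: "\<And>x. norm (g x) \<le> C"
    using compact_support_bounded[OF g S] by blast
  have int: "integrable lborel g" "integrable lborel (\<lambda>x. (norm (g x))\<^sup>2)"
    using S by (auto intro!: integrable_continuous_compact_support[of _ S] continuous_intros g)
  have "(LINT x|lborel. (norm (g x))\<^sup>2) = 0"
    using plancherel[OF g C int(1) gh] zero by simp
  then have "AE x in lborel. (norm (g x))\<^sup>2 = 0"
    using integral_nonneg_eq_0_iff_AE[OF int(2)] by simp
  then have "AE x in lborel. cis (- (2 * pi * (x \<bullet> \<xi>))) * g x = 0"
    by eventually_elim simp
  then show ?thesis
    unfolding fourier_eq_cis by (rule integral_eq_zero_AE)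
qed

theorem proposition3p1:
  fixes \<psi> :: "'a::euclidean_space \<Rightarrow> real"
    and \<mu> :: "'a measure" and f :: "'a \<Rightarrow> complex" and R :: real
  assumes "smooth \<psi>" and "compact (closure {x. \<psi> x \<noteq> 0})"
    and "\<And>x. 0 \<le> \<psi> x" and "(LINT x|lborel. \<psi> x) = 1"
    and "closure {x. \<psi> x \<noteq> 0} \<subseteq> cball 0 1"
    and "sets \<mu> = sets borel" and "compact (measure_support \<mu>)"
    and "integrable \<mu> f" and "integrable \<mu> (\<lambda>x. (norm (f x))\<^sup>2)"
    and "1 \<le> R"
  shows "sqrt (1 / (R ^ DIM('a) * measure lborel (neighborhood (1 / R) (function_support \<mu> f))))
           \<le> X_norm \<psi> 1 \<mu> R f / X_norm \<psi> 2 \<mu> R f"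
proof -
  define \<delta> where "\<delta> = 1 / R"
  have \<delta>: "0 < \<delta>"
    using assms(10) by (simp add: \<delta>_def)
  let ?\<phi> = "rescale \<delta> \<psi>"
  let ?E = "neighborhood \<delta> (function_support \<mu> f)"
  let ?m = "measure lborel ?E"
  have \<psi>: "continuous_on UNIV \<psi>"
    using assms(1) by (rule smooth_continuous)
  have \<psi>S: "\<psi> x = 0" if "x \<notin> closure {x. \<psi> x \<noteq> 0}" for x
    using that closure_subset[of "{x. \<psi> x \<noteq> 0}"] by auto
  have [measurable]: "\<psi> \<in> borel_measurable borel"
    using \<psi> by (rule borel_measurable_continuous_onI)
  \<comment> \<open>An open subset of the closed unit ball lies in its interior, so
    \<open>\<psi>\<close> also vanishes on the unit sphere, as \<open>conv_eq_0_outside\<close>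
    requires.\<close>
  have "open {x. \<psi> x \<noteq> 0}"
    by (intro open_Collect_neq \<psi> continuous_on_const)
  moreover have "{x. \<psi> x \<noteq> 0} \<subseteq> cball 0 1"
    using closure_subset assms(5) by (rule order_trans)
  ultimately have "{x. \<psi> x \<noteq> 0} \<subseteq> ball 0 1"
    by (metis interior_cball interior_maximal)
  then have \<psi>1: "\<psi> x = 0" if "1 \<le> norm x" for x
    using that by (force simp: not_less[symmetric])
  have \<phi>0: "?\<phi> z = 0" if "\<delta> \<le> norm z" for z
    using that \<delta> \<psi>1[of "z /\<^sub>R \<delta>"] by (simp add: rescale_def field_simps)
  have \<phi>S: "?\<phi> z = 0" if "z \<notin> cball 0 \<delta>" for z
    using \<phi>0[of z] that by simp
  have \<phi>: "continuous_on UNIV ?\<phi>"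
    unfolding rescale_def using \<delta>
    by (intro continuous_intros continuous_on_compose2[OF \<psi>]) auto
  obtain B where B: "\<And>x. norm (?\<phi> x) \<le> B"
    using compact_support_bounded[OF \<phi> compact_cball \<phi>S] by blast
  have \<phi>int: "integrable lborel ?\<phi>"
    using integrable_continuous_compact_support[OF \<phi> compact_cball \<phi>S] .
  have E: "open ?E"
    unfolding neighborhood_def by auto
  obtain r where r: "\<And>x. x \<in> measure_support \<mu> \<Longrightarrow> norm x \<le> r"
    using compact_imp_bounded[OF assms(7)] unfolding bounded_iff by blast
  have "?E \<subseteq> cball 0 (r + \<delta>)"
  proof
    fix x assume "x \<in> ?E"
    then obtain y where "y \<in> function_support \<mu> f" "dist y x < \<delta>"
      unfolding neighborhood_def by auto
    then show "x \<in> cball 0 (r + \<delta>)"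
      using r[of y] function_support_subset[OF assms(6), of f] norm_triangle_sub[of x y]
      by (force simp: dist_norm norm_minus_commute)
  qed
  then have Eb: "bounded ?E"
    using bounded_cball bounded_subset by blast
  show ?thesis
  proof (cases "?m = 0")
    case True
    \<comment> \<open>Division by zero yields 0, so the left side is 0, and the right side is a
      quotient of nonnegative numbers.\<close>
    then show ?thesis
      by (simp add: \<delta>_def X_norm_def)
  next
    case False
    \<comment> \<open>A null function has empty support, whose neighborhood has measure 0; that case
      is already settled.\<close>
    have nz: "\<not> (AE x in \<mu>. f x = 0)"
    proof
      assume "AE x in \<mu>. f x = 0"
      then have "function_support \<mu> f = {}"
        unfolding function_support_def by (auto intro!: exI[of _ UNIV])
      then show False
        using False by (simp add: neighborhood_def)
    qed
    obtain M h where M: "sigma_finite_measure M" "sets M = sets borel" and h: "integrable M h"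
      and conv: "\<And>\<phi>. \<phi> \<in> borel_measurable borel \<Longrightarrow> conv \<mu> f \<phi> = conv M h \<phi>"
      and AE: "(AE x in M. h x = 0) \<Longrightarrow> (AE x in \<mu>. f x = 0)"
      using finite_measure_polar[OF assms(6,8)] by blast
    define g where "g = conv \<mu> f ?\<phi>"
    have g_conv: "g = conv M h ?\<phi>"
      unfolding g_def by (rule conv) measurable
    let ?G = "fourier lborel g" and ?P = "fourier lborel (\<lambda>x. complex_of_real (?\<phi> x))"
    have G: "?G \<xi> = fourier M h \<xi> * ?P \<xi>" for \<xi>
      unfolding g_conv by (rule fourier_conv[OF M h \<phi>int])
    have g: "continuous_on UNIV g"
      unfolding g_conv by (rule continuous_on_conv[OF M(2) h \<phi> B])
    have gE: "g x = 0" if "x \<notin> ?E" for x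
      unfolding g_def by (rule conv_eq_0_outside[OF \<phi>0 that])
    then have gS: "compact (closure ?E)" "\<And>x. x \<notin> closure ?E \<Longrightarrow> g x = 0"
      using Eb closure_subset[of ?E] by (auto simp: compact_closure)
    have gint: "integrable lborel g"
      by (rule integrable_continuous_compact_support[OF g gS])
    have [measurable]: "?G \<in> borel_measurable borel"
      by (rule borel_measurable_fourier[OF _ gint]) simp
    have Pint: "integrable lborel ?P"
    proof -
      let ?Q = "fourier lborel (\<lambda>x. complex_of_real (\<psi> x))"
      have "integrable lborel \<psi>"
        using integrable_continuous_compact_support[OF \<psi> assms(2) \<psi>S] .
      then have [measurable]: "?Q \<in> borel_measurable borel"
        by (intro borel_measurable_fourier) auto
      have "integrable lborel ?Q"
        by (rule integrable_fourier_smooth[OF assms(1,2) \<psi>S]) measurable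
      then have "integrable lborel (\<lambda>\<xi>. ?Q (0 + \<delta> *\<^sub>R \<xi>))"
        using \<delta> by (subst integrable_lborel_affine) auto
      moreover have "(\<lambda>\<xi>. ?Q (0 + \<delta> *\<^sub>R \<xi>)) = ?P"
      proof
        show "?Q (0 + \<delta> *\<^sub>R \<xi>) = ?P \<xi>" for \<xi>
          using fourier_rescale[OF \<delta>, of \<psi> \<xi>] by simp
      qed
      ultimately show ?thesis
        by simp
    qed
    \<comment> \<open>The factor from \<open>h dM\<close> is bounded by the \<open>L^1\<close> norm
      of \<open>h\<close>, and the factor \<open>?P\<close> from the smooth kernel is
      integrable.\<close>
    have gh: "integrable lborel ?G"
    proof (rule Bochner_Integration.integrable_bound)
      show "integrable lborel (\<lambda>\<xi>. (LINT x|M. norm (h x)) *\<^sub>R ?P \<xi>)"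
        using Pint by (rule integrable_scaleR_right)
      show "AE \<xi> in lborel. norm (?G \<xi>) \<le> norm ((LINT x|M. norm (h x)) *\<^sub>R ?P \<xi>)"
        using norm_fourier_le[OF h]
        by (intro AE_I2) (auto simp: G norm_mult intro!: mult_right_mono order_trans[OF _ abs_ge_self])
    qed measurable
    let ?A = "LINT \<xi>|lborel. norm (?G \<xi>)" and ?B = "LINT \<xi>|lborel. (norm (?G \<xi>))\<^sup>2"
    \<comment> \<open>Otherwise the product of transforms vanishes identically; the kernel has mass
      1, so the transform of \<open>h dM\<close> vanishes, and uniqueness contradicts
      \<open>nz\<close>.\<close>
    have "?B \<noteq> 0"
    proof
      assume "?B = 0"
      then have "fourier M h \<xi> * ?P \<xi> = 0" for \<xi>
        using fourier_eq_0_if_integral_squared_eq_0[OF g gS gh] G by simp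
      moreover have "(LINT x|lborel. complex_of_real (?\<phi> x)) \<noteq> 0"
      proof -
        have "(LINT x|lborel. complex_of_real (?\<phi> x)) = ?P 0"
          by (simp add: fourier_eq_cis)
        also have "\<dots> = (LINT x|lborel. complex_of_real (\<psi> x))"
          using \<delta> by (subst fourier_rescale) (auto simp: fourier_eq_cis)
        also have "\<dots> = 1"
          using assms(4) by (simp add: integral_complex_of_real)
        finally show ?thesis
          by simp
      qed
      ultimately have "fourier M h \<xi> = 0" for \<xi>
        using mult_fourier_eq_0_imp_eq_0[of "\<lambda>x. complex_of_real (?\<phi> x)" "cball 0 \<delta>" "fourier M h"]
          continuous_on_of_real[OF \<phi>, where 'a = complex] continuous_on_fourier[OF M(2) h] \<phi>S
        by auto
      then show False
        using fourier_eq_0_imp_AE_eq_0[OF M h] AE nz by blast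
    qed
    moreover have "0 \<le> ?B" "0 \<le> ?A"
      by (auto intro!: Bochner_Integration.integral_nonneg)
    ultimately have "0 < ?B"
      by linarith
    have m: "0 < ?m"
      using False zero_less_measure_iff by blast
    have R: "0 < R"
      using assms(10) by simp
    have "sqrt ?B \<le> sqrt (?m * ?A\<^sup>2)"
      using integral_fourier_squared_le[OF g _ Eb gE gh] E by (intro real_sqrt_le_mono) auto
    also have "\<dots> = sqrt ?m * ?A"
      using \<open>0 \<le> ?A\<close> by (simp add: real_sqrt_mult)
    finally have le: "sqrt ?B \<le> sqrt ?m * ?A" .
    have X1: "X_norm \<psi> 1 \<mu> R f = ?A / R ^ DIM('a)"
      using R \<open>0 \<le> ?A\<close> by (simp add: X_norm_def g_def \<delta>_def)
    have X2: "X_norm \<psi> 2 \<mu> R f = sqrt ?B / sqrt (R ^ DIM('a))"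
      using R \<open>0 \<le> ?B\<close> by (simp add: X_norm_def g_def \<delta>_def powr_half_sqrt real_sqrt_divide)
    let ?d = "R ^ DIM('a)"
    have d: "0 < ?d"
      using R by simp
    have "sqrt (1 / (?d * ?m)) = 1 / (sqrt ?d * sqrt ?m)"
      by (simp add: real_sqrt_divide real_sqrt_mult)
    \<comment> \<open>This is \<open>le\<close> divided by \<open>sqrt ?m * sqrt ?B\<close>. The
      remaining \<open>sqrt ?d\<close> is what the normalisations \<open>1 / ?d\<close> in
      \<open>X1\<close> and \<open>1 / sqrt ?d\<close> in \<open>X2\<close> leave in the
      quotient.\<close>
    also have "\<dots> \<le> ?A / (sqrt ?d * sqrt ?B)"
      using le m d \<open>0 < ?B\<close> by (simp add: field_simps)
    also have "\<dots> = (?A / ?d) / (sqrt ?B / sqrt ?d)"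
    proof -
      have "a / (s * b) = (a / (s * s)) / (b / s)" if "s \<noteq> 0" for a b s :: real
        using that by simp
      from this[of "sqrt ?d" ?A "sqrt ?B"] show ?thesis
        using d by (simp only: real_sqrt_mult_self abs_of_pos real_sqrt_gt_0_iff less_imp_neq[symmetric] not_False_eq_True)
    qed
    finally show ?thesis
      unfolding X1 X2 by (simp add: \<delta>_def)
  qed
qed

end
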